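(* Let $ABC$ be a triangle and let $P$ be an ordinary point, not on the sides of $ABC$ or of its anticomplementary triangle, and not lying on $\iota(l_\infty)$. Let $Q$ be the isotomcomplement of $P$ and let $H$ be the generalized orthocenter for $P$ with respect to $ABC$. If $H \neq A, B, C$, then the isogonal conjugate $\gamma(H)$ is the perspector of the tangential triangle of $ABC$ and the circumcevian triangle of $\gamma(Q)$, both taken with respect to the circumcircle of $ABC$.
   Context: We work in the Euclidean plane extended by its line at infinity $l_\infty$; points not on $l_\infty$ are called ordinary. $ABC$ is an ordinary non-degenerate triangle; its sides are the lines $BC, CA, AB$. $X_1X_2\cdot Y_1Y_2$ denotes the intersection of two lines. $K$ is the complement map (the homothety with center the centroid $G$ of $ABC$ and ratio $-1/2$), and $K^{-1}(ABC)$ is the anticomplementary triangle. $\iota$ is the isotomic map for $ABC$, given in barycentric coordinates by $(x:y:z)\mapsto(1/x:1/y:1/z)$; $\iota(l_\infty)$ is the Steiner circumellipse. Put $P'=\iota(P)$ and $Q=K(P')$ (the isotomcomplement of $P$). Let $DEF$ be the cevian triangle of $P$: $D=AP\cdot BC$, $E=BP\cdot CA$, $F=CP\cdot AB$. The generalized orthocenter $H$ of $P$ is the common point of the lines through $A,B,C$ parallel, respectively, to $QD,QE,QF$. $\gamma$ denotes the classical isogonal conjugation for $ABC$ (points of the circumcircle other than the vertices correspond to points of $l_\infty$). The tangential triangle of $ABC$ with respect to the circumcircle has as sides the tangents at $A,B,C$; its vertex corresponding to $A$ is the intersection of the tangents at $B$ and $C$ (possibly a point of $l_\infty$), and cyclically.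 The circumcevian triangle of a point $R$ with respect to the circumcircle is the triangle $A'B'C'$, where $A',B',C'$ are the second intersections of $AR,BR,CR$ with the circumcircle ($A'=A$ if $AR$ is tangent at $A$, and similarly for the others). The perspector of two triangles is the point common to the three lines joining corresponding vertices. *)

theory Defs
  imports "HOL-Analysis.Analysis"
begin

section \<open>The extended Euclidean plane\<close>

text \<open>
  A point of the extended plane is the class, up to a nonzero real factor, of a nonzero vector
  of homogeneous coordinates \<open>(u, t)\<close>. If \<open>t \<noteq> 0\<close> it is the ordinary point \<open>u / t\<close>; the
  class of \<open>(u, 0)\<close> is the point at infinity of the lines with direction \<open>u\<close>.
\<close>

definition proportional :: "(real^2) \<times> real \<Rightarrow> (real^2) \<times> real \<Rightarrow> bool" where
  "proportional v w \<longleftrightarrow> v \<noteq> 0 \<and> w \<noteq> 0 \<and> (\<exists>k. w = k *\<^sub>R v)"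

lemma proportional_factor:
  assumes "proportional v w"
  obtains k where "k \<noteq> 0" "w = k *\<^sub>R v" "v \<noteq> 0"
  using assms unfolding proportional_def by (metis scaleR_zero_left)

lemma proportionalI: "v \<noteq> 0 \<Longrightarrow> k \<noteq> 0 \<Longrightarrow> proportional v (k *\<^sub>R v)"
  unfolding proportional_def by auto

lemma proportional_sym: "proportional v w \<Longrightarrow> proportional w v"
proof -
  assume "proportional v w"
  then obtain k where k: "k \<noteq> 0" "w = k *\<^sub>R v" "v \<noteq> 0" by (rule proportional_factor)
  then have "v = inverse k *\<^sub>R w" "w \<noteq> 0" by auto
  then show "proportional w v" using k unfolding proportional_def by blast
qed

lemma proportional_trans: "proportional u v \<Longrightarrow> proportional v w \<Longrightarrow> proportional u w"
  by (auto simp: proportional_def)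

quotient_type ppoint = "(real^2) \<times> real" / partial: proportional
proof (rule part_equivpI)
  have "proportional (0, 1) (0, 1)"
    using proportionalI[of "(0, 1)" 1] by (simp add: zero_prod_def)
  then show "\<exists>x. proportional x x" ..
  show "symp proportional" by (rule sympI) (rule proportional_sym)
  show "transp proportional" by (rule transpI) (rule proportional_trans)
qed

lift_definition has_coords :: "ppoint \<Rightarrow> (real^2) \<times> real \<Rightarrow> bool" is proportional
  by (intro ext iffI) (blast intro: proportional_sym proportional_trans)+

lift_definition ordinary :: "real^2 \<Rightarrow> ppoint" is "\<lambda>X. (X, 1)"
  by (simp add: proportional_def zero_prod_def)

definition line_at_infinity :: "ppoint set" where
  "line_at_infinity = {X. \<exists>u. has_coords X (u, 0)}"

text \<open>If \<open>X = Y\<close> this is \<open>{X}\<close>, not a line.\<close>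

definition join :: "ppoint \<Rightarrow> ppoint \<Rightarrow> ppoint set" where
  "join X Y = {Z. \<exists>u v w. has_coords X u \<and> has_coords Y v \<and> has_coords Z w \<and> w \<in> span {u, v}}"

definition is_line :: "ppoint set \<Rightarrow> bool" where
  "is_line l \<longleftrightarrow> (\<exists>X Y. X \<noteq> Y \<and> l = join X Y)"

definition meet :: "ppoint set \<Rightarrow> ppoint set \<Rightarrow> ppoint" where
  "meet l m = (THE X. X \<in> l \<and> X \<in> m)"

definition parallel_through :: "ppoint \<Rightarrow> ppoint set \<Rightarrow> ppoint set" where
  "parallel_through X l = join X (meet l line_at_infinity)"

definition common_point :: "ppoint set \<Rightarrow> ppoint set \<Rightarrow> ppoint set \<Rightarrow> ppoint" where
  "common_point l m n = (THE X. X \<in> l \<and> X \<in> m \<and> X \<in> n)"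


section \<open>The isotomic map, the complement map and the generalized orthocenter\<close>

definition has_barycentric ::
    "real^2 \<Rightarrow> real^2 \<Rightarrow> real^2 \<Rightarrow> ppoint \<Rightarrow> real \<Rightarrow> real \<Rightarrow> real \<Rightarrow> bool" where
  "has_barycentric A B C X x y z \<longleftrightarrow>
     has_coords X (x *\<^sub>R (A, 1) + y *\<^sub>R (B, 1) + z *\<^sub>R (C, 1))"

text \<open>
  Here \<open>(1/x : 1/y : 1/z)\<close> is written without denominators, as \<open>(yz : zx : xy)\<close>, so that the map
  is defined at every point other than the vertices. In particular the image of the line at
  infinity is the whole Steiner circumellipse, its points at the vertices included.
\<close>

definition isotomic :: "real^2 \<Rightarrow> real^2 \<Rightarrow> real^2 \<Rightarrow> ppoint \<Rightarrow> ppoint" where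
  "isotomic A B C X = (THE Y. \<exists>x y z. has_barycentric A B C X x y z \<and>
     has_barycentric A B C Y (y * z) (z * x) (x * y))"

definition centroid :: "real^2 \<Rightarrow> real^2 \<Rightarrow> real^2 \<Rightarrow> real^2" where
  "centroid A B C = (1/3) *\<^sub>R (A + B + C)"

text \<open>
  On an ordinary point \<open>X = u / t\<close> this is \<open>X \<mapsto> G - (1/2) (X - G)\<close>; it fixes every point at
  infinity.
\<close>

lift_definition complement :: "real^2 \<Rightarrow> real^2 \<Rightarrow> real^2 \<Rightarrow> ppoint \<Rightarrow> ppoint" is
  "\<lambda>A B C (u, t). (t *\<^sub>R centroid A B C - (1/2) *\<^sub>R (u - t *\<^sub>R centroid A B C), t)"
proof -
  fix A B C :: "real^2" and v w :: "(real^2) \<times> real"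
  let ?f = "\<lambda>(u, t). (t *\<^sub>R centroid A B C - (1/2) *\<^sub>R (u - t *\<^sub>R centroid A B C), t)"
  assume "proportional v w"
  then obtain k where k: "k \<noteq> 0" "w = k *\<^sub>R v" "v \<noteq> 0" by (rule proportional_factor)
  have "?f w = k *\<^sub>R ?f v"
    using k(2) by (cases v) (simp add: algebra_simps)
  moreover have "?f v \<noteq> 0"
    using k(3) by (cases v) (auto simp: zero_prod_def)
  ultimately show "proportional (?f v) (?f w)"
    using k(1) by (simp add: proportionalI)
qed

definition isotomcomplement :: "real^2 \<Rightarrow> real^2 \<Rightarrow> real^2 \<Rightarrow> ppoint \<Rightarrow> ppoint" where
  "isotomcomplement A B C P = complement A B C (isotomic A B C P)"

text \<open>The union of the side lines; below, \<open>complement A B C -` sides A B C\<close> is the union of the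
  side lines of the anticomplementary triangle.\<close>

definition sides :: "real^2 \<Rightarrow> real^2 \<Rightarrow> real^2 \<Rightarrow> ppoint set" where
  "sides A B C = join (ordinary B) (ordinary C) \<union> join (ordinary C) (ordinary A)
     \<union> join (ordinary A) (ordinary B)"

type_synonym triangle = "ppoint \<times> ppoint \<times> ppoint"

definition cevian_triangle :: "real^2 \<Rightarrow> real^2 \<Rightarrow> real^2 \<Rightarrow> ppoint \<Rightarrow> triangle" where
  "cevian_triangle A B C P =
     (meet (join (ordinary A) P) (join (ordinary B) (ordinary C)),
      meet (join (ordinary B) P) (join (ordinary C) (ordinary A)),
      meet (join (ordinary C) P) (join (ordinary A) (ordinary B)))"

definition generalized_orthocenter :: "real^2 \<Rightarrow> real^2 \<Rightarrow> real^2 \<Rightarrow> ppoint \<Rightarrow> ppoint" where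
  "generalized_orthocenter A B C P =
     (case cevian_triangle A B C P of (D, E, F) \<Rightarrow>
      let Q = isotomcomplement A B C P in
      common_point (parallel_through (ordinary A) (join Q D))
                   (parallel_through (ordinary B) (join Q E))
                   (parallel_through (ordinary C) (join Q F)))"


section \<open>Isogonal conjugation\<close>

text \<open>
  The reflection in the line through the ordinary point \<open>V\<close> with normal vector \<open>n\<close>, extended to
  the points at infinity.
\<close>

lift_definition reflection :: "real^2 \<Rightarrow> real^2 \<Rightarrow> ppoint \<Rightarrow> ppoint" is
  "\<lambda>V n (u, t). (u - (2 * (((u - t *\<^sub>R V) \<bullet> n) / (n \<bullet> n))) *\<^sub>R n, t)"
proof -
  fix V n :: "real^2" and v w :: "(real^2) \<times> real"
  let ?f = "\<lambda>(u, t). (u - (2 * (((u - t *\<^sub>R V) \<bullet> n) / (n \<bullet> n))) *\<^sub>R n, t)"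
  assume "proportional v w"
  then obtain k where k: "k \<noteq> 0" "w = k *\<^sub>R v" "v \<noteq> 0" by (rule proportional_factor)
  have "?f w = k *\<^sub>R ?f v"
    using k(2) by (cases v) (simp add: inner_diff_left algebra_simps diff_divide_distrib)
  moreover have "?f v \<noteq> 0"
  proof
    obtain u t where v: "v = (u, t)" by (cases v)
    assume "?f v = 0"
    then have t: "t = 0" and u: "u = (2 * ((u \<bullet> n) / (n \<bullet> n))) *\<^sub>R n"
      using v by (auto simp: zero_prod_def)
    have "u \<bullet> n = (2 * ((u \<bullet> n) / (n \<bullet> n))) * (n \<bullet> n)"
      using arg_cong[OF u, where f = "\<lambda>x. x \<bullet> n"] by simp
    then have "u \<bullet> n = 0" by (cases "n = 0") auto
    then have "u = 0" using u by simp
    then show False using k(3) v t by (simp add: zero_prod_def)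
  qed
  ultimately show "proportional (?f v) (?f w)"
    using k(1) by (simp add: proportionalI)
qed

text \<open>
  The image of the line \<open>VX\<close> under the reflection in the bisector of the angle \<open>UVW\<close>. The
  difference of the unit vectors along \<open>VU\<close> and \<open>VW\<close> is normal to that bisector.
\<close>

definition isogonal_line :: "real^2 \<Rightarrow> real^2 \<Rightarrow> real^2 \<Rightarrow> ppoint \<Rightarrow> ppoint set" where
  "isogonal_line U V W X = reflection V (sgn (U - V) - sgn (W - V)) ` join (ordinary V) X"

definition isogonal :: "real^2 \<Rightarrow> real^2 \<Rightarrow> real^2 \<Rightarrow> ppoint \<Rightarrow> ppoint" where
  "isogonal A B C X =
     common_point (isogonal_line B A C X) (isogonal_line C B A X) (isogonal_line A C B X)"


section \<open>Triangles related to the circumcircle\<close>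

definition circumcircle :: "real^2 \<Rightarrow> real^2 \<Rightarrow> real^2 \<Rightarrow> (real^2) set" where
  "circumcircle A B C = (THE S. (\<exists>z r. S = sphere z r) \<and> A \<in> S \<and> B \<in> S \<and> C \<in> S)"

definition tangent_line :: "(real^2) set \<Rightarrow> real^2 \<Rightarrow> ppoint set" where
  "tangent_line S X = (THE l. is_line l \<and> l \<inter> ordinary ` S = {ordinary X})"

definition tangential_triangle :: "real^2 \<Rightarrow> real^2 \<Rightarrow> real^2 \<Rightarrow> triangle" where
  "tangential_triangle A B C =
     (let S = circumcircle A B C in
      (meet (tangent_line S B) (tangent_line S C),
       meet (tangent_line S C) (tangent_line S A),
       meet (tangent_line S A) (tangent_line S B)))"

text \<open>This is \<open>X\<close> itself when the line \<open>XR\<close> is tangent to the circle at \<open>X\<close>.\<close>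

definition second_intersection :: "(real^2) set \<Rightarrow> real^2 \<Rightarrow> ppoint \<Rightarrow> ppoint" where
  "second_intersection S X R =
     (THE Y. join (ordinary X) R \<inter> ordinary ` S = {ordinary X, Y})"

definition circumcevian_triangle :: "real^2 \<Rightarrow> real^2 \<Rightarrow> real^2 \<Rightarrow> ppoint \<Rightarrow> triangle" where
  "circumcevian_triangle A B C R =
     (let S = circumcircle A B C in
      (second_intersection S A R, second_intersection S B R, second_intersection S C R))"

definition is_perspector :: "ppoint \<Rightarrow> triangle \<Rightarrow> triangle \<Rightarrow> bool" where
  "is_perspector X T T' \<longleftrightarrow>
     (case (T, T') of ((A, B, C), (A', B', C')) \<Rightarrow>
      A \<noteq> A' \<and> B \<noteq> B' \<and> C \<noteq> C' \<and> join A A' \<inter> join B B' \<inter> join C C' = {X})"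

end

theory Submission
  imports Defs
begin

text \<open>
  Everything is computed in barycentric coordinates, with \<open>a\<close>, \<open>b\<close>, \<open>c\<close> the side lengths. Let
  \<open>P = (p1 : p2 : p3)\<close> and \<open>s = p2 p3 + p3 p1 + p1 p2\<close>. Then \<open>Q = (q1 : q2 : q3)\<close> with
  \<open>q1 = p1 (p2 + p3)\<close> and cyclically, and the direction of \<open>QD\<close> gives
  \<open>H = (p1 / (p1\<^sup>2 - s) : p2 / (p2\<^sup>2 - s) : p3 / (p3\<^sup>2 - s))\<close>; \<open>H\<close> is a vertex exactly when one
  of these denominators vanishes. Isogonal conjugation is
  \<open>(x : y : z) \<mapsto> (a\<^sup>2 y z : b\<^sup>2 z x : c\<^sup>2 x y)\<close> for points off the sides.

  The tangents at \<open>B\<close> and \<open>C\<close> meet in \<open>(- a\<^sup>2 : b\<^sup>2 : c\<^sup>2)\<close>, and the line \<open>A\<gamma>(Q)\<close> meets the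
  circumcircle \<open>a\<^sup>2 y z + b\<^sup>2 z x + c\<^sup>2 x y = 0\<close> again in
  \<open>(- a\<^sup>2 q2 q3 : b\<^sup>2 q3 (q2 + q3) : c\<^sup>2 q2 (q2 + q3))\<close>. In the coordinates
  \<open>X = x / a\<^sup>2, Y = y / b\<^sup>2, Z = z / c\<^sup>2\<close> the join of these two points is
  \<open>(q2\<^sup>2 - q3\<^sup>2) X + q2\<^sup>2 Y - q3\<^sup>2 Z = 0\<close>, and this line and its two cyclic companions have the
  common point \<open>X : Y : Z = (q2\<^sup>2 + q3\<^sup>2 - q1\<^sup>2) : (q3\<^sup>2 + q1\<^sup>2 - q2\<^sup>2) : (q1\<^sup>2 + q2\<^sup>2 - q3\<^sup>2)\<close>
  (lemma \<open>perspector_of_circumcevian\<close>). The theorem then rests on the identity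
  \<open>q2\<^sup>2 + q3\<^sup>2 - q1\<^sup>2 = 2 p2 p3 (s - p1\<^sup>2)\<close>, whose right-hand side is, up to a factor
  common to the three coordinates, the first coordinate of \<open>\<gamma>(H)\<close> divided by \<open>a\<^sup>2\<close>
  (lemma \<open>isogonal_generalized_orthocenter\<close>).

  Each construction is computed only at the vertex \<open>A\<close>; the other two cases are the same lemma for
  the triangle \<open>BCA\<close> or \<open>CAB\<close>, transported by the cyclic symmetry of barycentric coordinates.
\<close>

section \<open>Homogeneous and barycentric coordinates\<close>

lemma ex_coords: "\<exists>v. has_coords X v"
  by transfer blast

lemma has_coords_exists: "v \<noteq> 0 \<Longrightarrow> \<exists>X. has_coords X v"
  by transfer (use proportionalI[where k = 1] in auto)

lemma has_coords_nonzero: "has_coords X v \<Longrightarrow> v \<noteq> 0"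
  by transfer (simp add: proportional_def)

lemma has_coords_proportional: "has_coords X v \<Longrightarrow> has_coords X w \<longleftrightarrow> proportional v w"
  by transfer (blast intro: proportional_sym proportional_trans)

lemma has_coords_eq: "has_coords X v \<Longrightarrow> has_coords Y v \<Longrightarrow> X = Y"
  by transfer (blast intro: proportional_sym proportional_trans)

lemma has_coords_ordinary: "has_coords (ordinary p) (p, 1)"
  by transfer (simp add: proportional_def zero_prod_def)

definition bary_vec :: "real^2 \<Rightarrow> real^2 \<Rightarrow> real^2 \<Rightarrow> real \<Rightarrow> real \<Rightarrow> real \<Rightarrow> (real^2) \<times> real" where
  "bary_vec A B C x y z = x *\<^sub>R (A, 1) + y *\<^sub>R (B, 1) + z *\<^sub>R (C, 1)"

definition bary_point :: "real^2 \<Rightarrow> real^2 \<Rightarrow> real^2 \<Rightarrow> real \<Rightarrow> real \<Rightarrow> real \<Rightarrow> ppoint" where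
  "bary_point A B C x y z = (THE X. has_barycentric A B C X x y z)"

definition bary_line :: "real^2 \<Rightarrow> real^2 \<Rightarrow> real^2 \<Rightarrow> real \<Rightarrow> real \<Rightarrow> real \<Rightarrow> ppoint set" where
  "bary_line A B C l m n =
     {X. \<exists>x y z. has_barycentric A B C X x y z \<and> l * x + m * y + n * z = 0}"

lemma has_barycentric_cyclic: "has_barycentric B C A X y z x = has_barycentric A B C X x y z"
  by (simp add: has_barycentric_def add_ac)

lemma bary_point_cyclic: "bary_point B C A y z x = bary_point A B C x y z"
  unfolding bary_point_def has_barycentric_cyclic[of B C A] ..

lemma bary_line_cyclic: "bary_line B C A m n l = bary_line A B C l m n"
proof -
  have e: "has_barycentric B C A X y z x \<and> m * y + n * z + l * x = 0 \<longleftrightarrow>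
      has_barycentric A B C X x y z \<and> l * x + m * y + n * z = 0" for X x y z
    unfolding has_barycentric_cyclic[of B C A X y z x] by auto
  have "(\<exists>y z x. has_barycentric B C A X y z x \<and> m * y + n * z + l * x = 0) \<longleftrightarrow>
     (\<exists>x y z. has_barycentric A B C X x y z \<and> l * x + m * y + n * z = 0)" for X
    unfolding e by blast
  then show ?thesis unfolding bary_line_def by blast
qed

lemma linear_system_2:
  fixes y z :: real
  assumes "y * b + z * c = 0" "y * b' + z * c' = 0" "b * c' - b' * c \<noteq> 0"
  shows "y = 0 \<and> z = 0"
proof -
  have "y * (b * c' - b' * c) = 0" "z * (b * c' - b' * c) = 0"
    using assms(1,2) by algebra+
  with assms(3) show ?thesis by (metis mult_eq_0_iff)
qed

locale nondegenerate_triangle =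
  fixes A B C :: "real^2"
  assumes noncollinear: "\<not> collinear {A, B, C}"
begin

abbreviation "bpt \<equiv> bary_point A B C"
abbreviation "bln \<equiv> bary_line A B C"
abbreviation "bv \<equiv> bary_vec A B C"

lemma cyclic: "nondegenerate_triangle B C A"
proof -
  have "{B, C, A} = {A, B, C}" by blast
  with noncollinear show ?thesis by (simp only: nondegenerate_triangle_def simp_thms)
qed

lemma vertices_distinct: "A \<noteq> B" "B \<noteq> C" "C \<noteq> A"
  using noncollinear by (auto simp: insert_absorb2 insert_commute)

text \<open>Twice the signed area; by Cramer's rule its not vanishing makes barycentric coordinates a
  linear coordinate system on homogeneous vectors and provides the circumcenter.\<close>
lemma area_nonzero:
  "(B$1 - A$1) * (C$2 - A$2) - (B$2 - A$2) * (C$1 - A$1) \<noteq> 0" (is "?d \<noteq> 0")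
proof
  assume d: "?d = 0"
  have "collinear {0, B - A, C - A}"
  proof (cases "B$1 = A$1")
    case B1: True
    show ?thesis
    proof (cases "B$2 = A$2")
      case True
      with B1 have "B - A = 0" by (simp add: vec_eq_iff forall_2)
      then show ?thesis by (simp add: collinear_lemma)
    next
      case False
      with B1 d have "C - A = ((C$2 - A$2) / (B$2 - A$2)) *\<^sub>R (B - A)"
        by (simp add: vec_eq_iff forall_2)
      then show ?thesis unfolding collinear_lemma by blast
    qed
  next
    case False
    moreover have "C$2 - A$2 = (C$1 - A$1) * (B$2 - A$2) / (B$1 - A$1)"
      using d False by (simp add: eq_divide_eq mult.commute)
    ultimately have "C - A = ((C$1 - A$1) / (B$1 - A$1)) *\<^sub>R (B - A)"
      by (simp add: vec_eq_iff forall_2)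
    then show ?thesis unfolding collinear_lemma by blast
  qed
  then have "collinear {B, A, C}" by (subst collinear_3) (simp_all add: NO_MATCH_def)
  moreover have "{B, A, C} = {A, B, C}" by blast
  ultimately show False using noncollinear by (simp only: simp_thms)
qed

lemma bary_vec_eq_0: "bv x y z = 0 \<longleftrightarrow> (x, y, z) = (0, 0, 0)"
proof
  assume h: "bv x y z = 0"
  then have x: "x = - y - z" and
    s: "x * A$1 + y * B$1 + z * C$1 = 0" "x * A$2 + y * B$2 + z * C$2 = 0"
    by (simp_all add: bary_vec_def zero_prod_def vec_eq_iff forall_2)
  have "y * (B$1 - A$1) + z * (C$1 - A$1) = 0" "y * (B$2 - A$2) + z * (C$2 - A$2) = 0"
    using s unfolding x by (simp_all add: algebra_simps)
  then have "y = 0 \<and> z = 0" using area_nonzero by (rule linear_system_2)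
  with x show "(x, y, z) = (0, 0, 0)" by simp
qed (simp add: bary_vec_def zero_prod_def)

lemma bary_vec_surj: "\<exists>x y z. v = bv x y z"
proof -
  obtain u t where v: "v = (u, t)" by (cases v)
  let ?d = "(B$1 - A$1) * (C$2 - A$2) - (B$2 - A$2) * (C$1 - A$1)"
  define y where "y = ((u$1 - t * A$1) * (C$2 - A$2) - (u$2 - t * A$2) * (C$1 - A$1)) / ?d"
  define z where "z = ((B$1 - A$1) * (u$2 - t * A$2) - (B$2 - A$2) * (u$1 - t * A$1)) / ?d"
  have yd: "y * ?d = (u$1 - t * A$1) * (C$2 - A$2) - (u$2 - t * A$2) * (C$1 - A$1)"
    and zd: "z * ?d = (B$1 - A$1) * (u$2 - t * A$2) - (B$2 - A$2) * (u$1 - t * A$1)"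
    using area_nonzero by (simp_all add: y_def z_def)
  have "?d * (y * (B$1 - A$1) + z * (C$1 - A$1) - (u$1 - t * A$1)) = 0"
    "?d * (y * (B$2 - A$2) + z * (C$2 - A$2) - (u$2 - t * A$2)) = 0"
    using yd zd by algebra+
  with area_nonzero have e: "u$1 - t * A$1 = y * (B$1 - A$1) + z * (C$1 - A$1)"
    "u$2 - t * A$2 = y * (B$2 - A$2) + z * (C$2 - A$2)"
    unfolding mult_eq_0_iff by linarith+
  have "u = (t - y - z) *\<^sub>R A + y *\<^sub>R B + z *\<^sub>R C"
    unfolding vec_eq_iff forall_2 using e by (simp add: algebra_simps)
  then have "v = bv (t - y - z) y z"
    by (simp add: bary_vec_def v)
  then show ?thesis by blast
qed

lemma bary_vec_inject: "bv x y z = bv x' y' z' \<longleftrightarrow> x = x' \<and> y = y' \<and> z = z'"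
proof -
  have "bv (x - x') (y - y') (z - z') = bv x y z - bv x' y' z'"
    by (simp add: bary_vec_def algebra_simps)
  then have "bv x y z = bv x' y' z' \<longleftrightarrow> bv (x - x') (y - y') (z - z') = 0"
    by simp
  then show ?thesis unfolding bary_vec_eq_0 by simp
qed

lemma bary_vec_scale: "k *\<^sub>R bv x y z = bv (k * x) (k * y) (k * z)"
  by (simp add: bary_vec_def scaleR_add_right distrib_left)

lemma bary_vec_add: "bv x y z + bv x' y' z' = bv (x + x') (y + y') (z + z')"
  by (simp add: bary_vec_def algebra_simps)

lemma has_barycentric_iff: "has_barycentric A B C X x y z \<longleftrightarrow> has_coords X (bv x y z)"
  by (simp add: has_barycentric_def bary_vec_def)

lemma has_barycentric_bpt: "has_barycentric A B C X x y z \<longleftrightarrow> (x, y, z) \<noteq> (0, 0, 0) \<and> X = bpt x y z"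
proof
  assume h: "has_barycentric A B C X x y z"
  then have "(THE X. has_barycentric A B C X x y z) = X"
    by (rule the_equality) (use h in \<open>simp add: has_barycentric_iff has_coords_eq\<close>)
  then show "(x, y, z) \<noteq> (0, 0, 0) \<and> X = bpt x y z"
    using h has_coords_nonzero[of X "bv x y z"] bary_vec_eq_0[of x y z]
    by (auto simp: bary_point_def has_barycentric_iff)
next
  assume h: "(x, y, z) \<noteq> (0, 0, 0) \<and> X = bpt x y z"
  then obtain Y where Y: "has_barycentric A B C Y x y z"
    using has_coords_exists[of "bv x y z"] bary_vec_eq_0[of x y z] by (auto simp: has_barycentric_iff)
  then have "(THE X. has_barycentric A B C X x y z) = Y"
    by (rule the_equality) (use Y in \<open>simp add: has_barycentric_iff has_coords_eq\<close>)
  with h Y show "has_barycentric A B C X x y z" by (simp add: bary_point_def)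
qed

lemma has_coords_bpt: "(x, y, z) \<noteq> (0, 0, 0) \<Longrightarrow> has_coords (bpt x y z) (bv x y z)"
  by (simp add: has_barycentric_bpt flip: has_barycentric_iff)

lemma bpt_cases:
  obtains x y z where "(x, y, z) \<noteq> (0, 0, 0)" "X = bpt x y z"
proof -
  obtain v where v: "has_coords X v" using ex_coords by blast
  obtain x y z where "v = bv x y z" using bary_vec_surj by blast
  with v have "has_barycentric A B C X x y z" by (simp add: has_barycentric_iff)
  then show ?thesis using that unfolding has_barycentric_bpt by blast
qed

lemma bpt_eq_iff:
  assumes "(x, y, z) \<noteq> (0, 0, 0)" "(x', y', z') \<noteq> (0, 0, 0)"
  shows "bpt x y z = bpt x' y' z' \<longleftrightarrow> (\<exists>k. k \<noteq> 0 \<and> x' = k * x \<and> y' = k * y \<and> z' = k * z)"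
proof -
  have "bpt x y z = bpt x' y' z' \<longleftrightarrow> proportional (bv x y z) (bv x' y' z')"
    using has_coords_proportional[OF has_coords_bpt[OF assms(1)]] has_coords_bpt[OF assms(2)]
      has_coords_eq by (cases "bv x' y' z'") auto
  also have "\<dots> \<longleftrightarrow> (\<exists>k. bv x' y' z' = k *\<^sub>R bv x y z)"
    using assms unfolding proportional_def bary_vec_eq_0 by blast
  also have "\<dots> \<longleftrightarrow> (\<exists>k. k \<noteq> 0 \<and> x' = k * x \<and> y' = k * y \<and> z' = k * z)"
    unfolding bary_vec_scale bary_vec_inject
    by (rule ex_cong1) (use assms(2) in auto)
  finally show ?thesis .
qed

lemma bpt_scale: "k \<noteq> 0 \<Longrightarrow> bpt (k * x) (k * y) (k * z) = bpt x y z"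
proof (cases "(x, y, z) = (0, 0, 0)")
  case False
  assume "k \<noteq> 0"
  with False have "bpt x y z = bpt (k * x) (k * y) (k * z)"
    using \<open>k \<noteq> 0\<close> by (subst bpt_eq_iff) (simp, simp, blast)
  then show ?thesis by simp
qed simp

lemma bpt_in_bln: "(x, y, z) \<noteq> (0, 0, 0) \<Longrightarrow> bpt x y z \<in> bln l m n \<longleftrightarrow> l * x + m * y + n * z = 0"
proof
  assume nz: "(x, y, z) \<noteq> (0, 0, 0)" and "bpt x y z \<in> bln l m n"
  then obtain x' y' z' where nz': "(x', y', z') \<noteq> (0, 0, 0)"
    and eq: "bpt x' y' z' = bpt x y z" and e: "l * x' + m * y' + n * z' = 0"
    unfolding bary_line_def has_barycentric_bpt mem_Collect_eq by (elim exE conjE) simp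
  from eq obtain k where "x = k * x'" "y = k * y'" "z = k * z'"
    unfolding bpt_eq_iff[OF nz' nz] by blast
  then have "l * x + m * y + n * z = k * (l * x' + m * y' + n * z')"
    by (simp add: algebra_simps)
  with e show "l * x + m * y + n * z = 0" by simp
next
  assume "(x, y, z) \<noteq> (0, 0, 0)" "l * x + m * y + n * z = 0"
  then show "bpt x y z \<in> bln l m n"
    unfolding bary_line_def has_barycentric_bpt by blast
qed

lemma bln_eqI:
  assumes "\<And>x y z. (x, y, z) \<noteq> (0, 0, 0) \<Longrightarrow> bpt x y z \<in> L \<longleftrightarrow> l * x + m * y + n * z = 0"
  shows "L = bln l m n"
proof (rule set_eqI)
  fix X
  obtain x y z where "(x, y, z) \<noteq> (0, 0, 0)" "X = bpt x y z" by (rule bpt_cases)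
  then show "X \<in> L \<longleftrightarrow> X \<in> bln l m n" using assms bpt_in_bln by simp
qed

lemma bln_scale: "k \<noteq> 0 \<Longrightarrow> bln (k * l) (k * m) (k * n) = bln l m n"
proof (rule bln_eqI)
  fix x y z :: real
  assume "k \<noteq> 0" "(x, y, z) \<noteq> (0, 0, 0)"
  moreover have "k * l * x + k * m * y + k * n * z = k * (l * x + m * y + n * z)"
    by (simp add: algebra_simps)
  ultimately show "bpt x y z \<in> bln (k * l) (k * m) (k * n) \<longleftrightarrow> l * x + m * y + n * z = 0"
    unfolding bpt_in_bln[OF \<open>(x, y, z) \<noteq> (0, 0, 0)\<close>] by simp
qed

end

section \<open>Incidence in barycentric coordinates\<close>

lemma in_span_2: "w \<in> span {u, v} \<longleftrightarrow> (\<exists>s t. w = s *\<^sub>R u + t *\<^sub>R v)"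
proof -
  have "w - s *\<^sub>R u = t *\<^sub>R v \<longleftrightarrow> w = s *\<^sub>R u + t *\<^sub>R v" for s t
    by (metis add.commute diff_eq_eq)
  then show ?thesis unfolding span_breakdown_eq span_singleton by blast
qed

text \<open>A vector orthogonal to a nonzero cross product \<open>v \<times> v'\<close> lies in the plane of \<open>v\<close> and \<open>v'\<close>: solve
  for the two coefficients by Cramer's rule in the coordinate plane where the cross product has a
  nonzero component.\<close>
lemma combination_of_cross:
  fixes x y z :: real
  assumes "(y * z' - z * y', z * x' - x * z', x * y' - y * x') \<noteq> (0, 0, 0)"
    and d: "(y * z' - z * y') * a + (z * x' - x * z') * b + (x * y' - y * x') * c = 0"
  shows "\<exists>s t. a = s * x + t * x' \<and> b = s * y + t * y' \<and> c = s * z + t * z'"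
proof -
  have *: "\<exists>s t. a = s * x + t * x' \<and> b = s * y + t * y' \<and> c = s * z + t * z'"
    if "x * y' - y * x' \<noteq> 0"
      and "(y * z' - z * y') * a + (z * x' - x * z') * b + (x * y' - y * x') * c = 0"
    for a b c x y z x' y' z' :: real
  proof -
    let ?m = "x * y' - y * x'"
    have "?m * a = (a * y' - b * x') * x + (x * b - y * a) * x'"
      "?m * b = (a * y' - b * x') * y + (x * b - y * a) * y'"
      by (simp_all add: algebra_simps)
    moreover have "?m * c = (a * y' - b * x') * z + (x * b - y * a) * z'"
      using that(2) by (simp add: algebra_simps)
    ultimately have "a = (a * y' - b * x') / ?m * x + (x * b - y * a) / ?m * x'"
      "b = (a * y' - b * x') / ?m * y + (x * b - y * a) / ?m * y'"
      "c = (a * y' - b * x') / ?m * z + (x * b - y * a) / ?m * z'"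
      using that(1) by (simp_all add: eq_divide_eq mult.commute flip: add_divide_distrib)
    then show ?thesis by blast
  qed
  consider "x * y' - y * x' \<noteq> 0" | "y * z' - z * y' \<noteq> 0" | "z * x' - x * z' \<noteq> 0"
    using assms(1) by auto
  then show ?thesis
  proof cases
    case 1
    then show ?thesis using d by (rule *)
  next
    case 2
    then have "\<exists>s t. b = s * y + t * y' \<and> c = s * z + t * z' \<and> a = s * x + t * x'"
      by (rule *) (use d in linarith)
    then show ?thesis by blast
  next
    case 3
    then have "\<exists>s t. c = s * z + t * z' \<and> a = s * x + t * x' \<and> b = s * y + t * y'"
      by (rule *) (use d in linarith)
    then show ?thesis by blast
  qed
qed

context nondegenerate_triangle
begin

lemma has_coords_bpt_iff:
  assumes "(x, y, z) \<noteq> (0, 0, 0)"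
  shows "has_coords (bpt x y z) v \<longleftrightarrow> (\<exists>k. k \<noteq> 0 \<and> v = bv (k * x) (k * y) (k * z))"
proof -
  have "bv x y z \<noteq> 0" using assms unfolding bary_vec_eq_0 .
  then show ?thesis
    unfolding has_coords_proportional[OF has_coords_bpt[OF assms]]
    unfolding proportional_def bary_vec_scale[symmetric]
    by (metis scaleR_eq_0_iff scaleR_zero_left)
qed

lemma bpt_eqI:
  assumes "(x, y, z) \<noteq> (0, 0, 0)" "(x', y', z') \<noteq> (0, 0, 0)"
    and e: "y * z' = z * y'" "z * x' = x * z'" "x * y' = y * x'"
  shows "bpt x y z = bpt x' y' z'"
proof -
  have "\<exists>k. x' = k * x \<and> y' = k * y \<and> z' = k * z"
  proof -
    consider "x \<noteq> 0" | "y \<noteq> 0" | "z \<noteq> 0" using assms(1) by auto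
    then show ?thesis
    proof cases
      case 1
      then show ?thesis using e by (intro exI[of _ "x' / x"]) (simp add: eq_divide_eq mult.commute)
    next
      case 2
      then show ?thesis using e by (intro exI[of _ "y' / y"]) (simp add: eq_divide_eq mult.commute)
    next
      case 3
      then show ?thesis using e by (intro exI[of _ "z' / z"]) (simp add: eq_divide_eq mult.commute)
    qed
  qed
  then obtain k where k: "x' = k * x" "y' = k * y" "z' = k * z" by blast
  then have "k \<noteq> 0" using assms(2) by auto
  then show ?thesis unfolding k by (rule bpt_scale[symmetric])
qed

lemma bpt_neqI:
  assumes "(y * z' - z * y', z * x' - x * z', x * y' - y * x') \<noteq> (0, 0, 0)"
  shows "bpt x y z \<noteq> bpt x' y' z'"
proof
  have nz: "(x, y, z) \<noteq> (0, 0, 0)" "(x', y', z') \<noteq> (0, 0, 0)" using assms by auto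
  assume "bpt x y z = bpt x' y' z'"
  then obtain k where "x' = k * x" "y' = k * y" "z' = k * z"
    unfolding bpt_eq_iff[OF nz] by blast
  with assms show False by simp
qed

lemma join_bpt:
  assumes "(y * z' - z * y', z * x' - x * z', x * y' - y * x') \<noteq> (0, 0, 0)"
  shows "join (bpt x y z) (bpt x' y' z') =
    bln (y * z' - z * y') (z * x' - x * z') (x * y' - y * x')"
proof (rule bln_eqI)
  fix a b c :: real
  assume nz: "(a, b, c) \<noteq> (0, 0, 0)"
  have nz': "(x, y, z) \<noteq> (0, 0, 0)" "(x', y', z') \<noteq> (0, 0, 0)" using assms by auto
  have "bpt a b c \<in> join (bpt x y z) (bpt x' y' z') \<longleftrightarrow>
    (\<exists>k k' j s t. k \<noteq> 0 \<and> k' \<noteq> 0 \<and> j \<noteq> 0 \<and>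
       bv (j * a) (j * b) (j * c) = s *\<^sub>R bv (k * x) (k * y) (k * z) + t *\<^sub>R bv (k' * x') (k' * y') (k' * z'))"
    unfolding join_def mem_Collect_eq in_span_2 has_coords_bpt_iff[OF nz]
      has_coords_bpt_iff[OF nz'(1)] has_coords_bpt_iff[OF nz'(2)]
    by blast
  also have "\<dots> \<longleftrightarrow> (\<exists>k k' j s t. k \<noteq> 0 \<and> k' \<noteq> 0 \<and> j \<noteq> 0 \<and>
      j * a = s * (k * x) + t * (k' * x') \<and> j * b = s * (k * y) + t * (k' * y') \<and>
      j * c = s * (k * z) + t * (k' * z'))"
    unfolding bary_vec_scale bary_vec_add bary_vec_inject ..
  also have "\<dots> \<longleftrightarrow> (y * z' - z * y') * a + (z * x' - x * z') * b + (x * y' - y * x') * c = 0"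
    (is "?L \<longleftrightarrow> ?d = 0")
  proof
    assume ?L
    then obtain k k' j s t where j: "j \<noteq> 0" and "j * a = s * (k * x) + t * (k' * x')"
      "j * b = s * (k * y) + t * (k' * y')" "j * c = s * (k * z) + t * (k' * z')" by blast
    moreover have "j * ?d = (y * z' - z * y') * (j * a) + (z * x' - x * z') * (j * b)
      + (x * y' - y * x') * (j * c)" by (simp add: algebra_simps)
    ultimately have "j * ?d = 0" by (simp add: algebra_simps)
    with j show "?d = 0" unfolding mult_eq_0_iff by blast
  next
    assume "?d = 0"
    then obtain s t where "a = s * x + t * x'" "b = s * y + t * y'" "c = s * z + t * z'"
      using combination_of_cross[OF assms] by blast
    then show ?L
      by (intro exI[of _ "1::real"] exI[of _ s] exI[of _ t] conjI) simp_all
  qed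
  finally show "bpt a b c \<in> join (bpt x y z) (bpt x' y' z') \<longleftrightarrow>
    (y * z' - z * y') * a + (z * x' - x * z') * b + (x * y' - y * x') * c = 0" .
qed

lemma bln_Int_bln:
  assumes "(m * n' - n * m', n * l' - l * n', l * m' - m * l') \<noteq> (0, 0, 0)"
  shows "bln l m n \<inter> bln l' m' n' = {bpt (m * n' - n * m') (n * l' - l * n') (l * m' - m * l')}"
    (is "_ = {?P}")
proof
  show "{?P} \<subseteq> bln l m n \<inter> bln l' m' n'"
    unfolding Int_iff insert_subset bpt_in_bln[OF assms] by (simp add: algebra_simps)
  show "bln l m n \<inter> bln l' m' n' \<subseteq> {?P}"
  proof
    fix X assume X: "X \<in> bln l m n \<inter> bln l' m' n'"
    obtain x y z where nz: "(x, y, z) \<noteq> (0, 0, 0)" and Xe: "X = bpt x y z" by (rule bpt_cases)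
    from X have e: "l * x + m * y + n * z = 0" "l' * x + m' * y + n' * z = 0"
      unfolding Xe using bpt_in_bln[OF nz] by auto
    have "X = ?P" unfolding Xe
      by (rule bpt_eqI[OF nz assms]) (use e in algebra)+
    then show "X \<in> {?P}" by simp
  qed
qed

lemma meet_bln:
  assumes "(m * n' - n * m', n * l' - l * n', l * m' - m * l') \<noteq> (0, 0, 0)"
  shows "meet (bln l m n) (bln l' m' n') = bpt (m * n' - n * m') (n * l' - l * n') (l * m' - m * l')"
  unfolding meet_def using bln_Int_bln[OF assms] by (intro the_equality) blast+

text \<open>One line through each vertex. Each line fixes the ratio of two coordinates, and the three ratios
  together fix the point, so no distinctness of the three lines has to be checked.\<close>
lemma common_point_cevians:
  assumes "(m, n) \<noteq> (0, 0)" "(n', l') \<noteq> (0, 0)" "(l'', m'') \<noteq> (0, 0)"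
    and nz: "(x, y, z) \<noteq> (0, 0, 0)"
    and e: "m * y + n * z = 0" "n' * z + l' * x = 0" "l'' * x + m'' * y = 0"
  shows "common_point (bln 0 m n) (bln l' 0 n') (bln l'' m'' 0) = bpt x y z"
proof -
  have par: "b * z = c * y" if "(m, n) \<noteq> (0, 0)" "m * y + n * z = 0" "m * b + n * c = 0"
    for m n y z b c :: real
  proof -
    have "m * (b * z - c * y) = 0" "n * (b * z - c * y) = 0" using that(2,3) by algebra+
    with that(1) show ?thesis by auto
  qed
  show ?thesis unfolding common_point_def
  proof (rule the_equality)
    show "bpt x y z \<in> bln 0 m n \<and> bpt x y z \<in> bln l' 0 n' \<and> bpt x y z \<in> bln l'' m'' 0"
      unfolding bpt_in_bln[OF nz] using e by simp
  next
    fix X assume X: "X \<in> bln 0 m n \<and> X \<in> bln l' 0 n' \<and> X \<in> bln l'' m'' 0"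
    obtain a b c where nz': "(a, b, c) \<noteq> (0, 0, 0)" and Xe: "X = bpt a b c" by (rule bpt_cases)
    from X have e': "m * b + n * c = 0" "n' * c + l' * a = 0" "l'' * a + m'' * b = 0"
      unfolding Xe bpt_in_bln[OF nz'] by auto
    have "b * z = c * y" "c * x = a * z" "a * y = b * x"
      using par[OF assms(1) e(1) e'(1)] par[OF assms(2) e(2) e'(2)] par[OF assms(3) e(3) e'(3)] .
    then show "X = bpt x y z" unfolding Xe by (intro bpt_eqI nz nz')
  qed
qed

lemma ordinary_bpt:
  assumes "x + y + z = 1"
  shows "ordinary (x *\<^sub>R A + y *\<^sub>R B + z *\<^sub>R C) = bpt x y z"
proof -
  have "(x, y, z) \<noteq> (0, 0, 0)" using assms by auto
  moreover have "bv x y z = (x *\<^sub>R A + y *\<^sub>R B + z *\<^sub>R C, 1)"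
    using assms by (simp add: bary_vec_def)
  ultimately show ?thesis
    using has_coords_bpt has_coords_ordinary has_coords_eq by metis
qed

lemma ordinary_vertices: "ordinary A = bpt 1 0 0" "ordinary B = bpt 0 1 0" "ordinary C = bpt 0 0 1"
  using ordinary_bpt[of 1 0 0] ordinary_bpt[of 0 1 0] ordinary_bpt[of 0 0 1] by simp_all

lemma line_at_infinity_bln: "line_at_infinity = bln 1 1 1"
proof (rule bln_eqI)
  fix x y z :: real
  assume nz: "(x, y, z) \<noteq> (0, 0, 0)"
  have "bpt x y z \<in> line_at_infinity \<longleftrightarrow> (\<exists>u k. k \<noteq> 0 \<and> (u, 0) = bv (k * x) (k * y) (k * z))"
    unfolding line_at_infinity_def mem_Collect_eq has_coords_bpt_iff[OF nz] ..
  also have "\<dots> \<longleftrightarrow> (\<exists>k. k \<noteq> 0 \<and> k * (x + y + z) = 0)"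
    by (auto simp: bary_vec_def distrib_left)
  also have "\<dots> \<longleftrightarrow> 1 * x + 1 * y + 1 * z = 0" by (auto intro: exI[of _ 1])
  finally show "bpt x y z \<in> line_at_infinity \<longleftrightarrow> 1 * x + 1 * y + 1 * z = 0" .
qed

lemma cevian_A: "(y, z) \<noteq> (0, 0) \<Longrightarrow> join (ordinary A) (bpt x y z) = bln 0 (- z) y"
  unfolding ordinary_vertices by (subst join_bpt) auto

lemma side_A: "join (ordinary B) (ordinary C) = bln 1 0 0"
  unfolding ordinary_vertices by (subst join_bpt) auto


lemma sides_bln: "sides A B C = bln 1 0 0 \<union> bln 0 1 0 \<union> bln 0 0 1"
proof -
  interpret BCA: nondegenerate_triangle B C A by (rule cyclic)
  interpret CAB: nondegenerate_triangle C A B by (rule BCA.cyclic)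
  show ?thesis
    unfolding sides_def side_A BCA.side_A CAB.side_A
      bary_line_cyclic[of B C A] bary_line_cyclic[of A B C, symmetric] ..
qed

lemma is_line_bln:
  assumes "is_line L"
  obtains l m n where "(l, m, n) \<noteq> (0, 0, 0)" "L = bln l m n"
proof -
  obtain X Y where XY: "X \<noteq> Y" "L = join X Y" using assms unfolding is_line_def by blast
  obtain x y z where nz: "(x, y, z) \<noteq> (0, 0, 0)" and X: "X = bpt x y z" by (rule bpt_cases)
  obtain x' y' z' where nz': "(x', y', z') \<noteq> (0, 0, 0)" and Y: "Y = bpt x' y' z'" by (rule bpt_cases)
  have c: "(y * z' - z * y', z * x' - x * z', x * y' - y * x') \<noteq> (0, 0, 0)"
  proof
    assume "(y * z' - z * y', z * x' - x * z', x * y' - y * x') = (0, 0, 0)"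
    then have "X = Y" unfolding X Y by (intro bpt_eqI nz nz') auto
    with XY show False by simp
  qed
  show ?thesis using that[OF c] XY(2) unfolding X Y join_bpt[OF c] by blast
qed

end

section \<open>The isotomcomplement and the generalized orthocenter\<close>

lemma has_coords_complement:
  "has_coords X (u, t) \<Longrightarrow>
    has_coords (complement A B C X) (t *\<^sub>R centroid A B C - (1/2) *\<^sub>R (u - t *\<^sub>R centroid A B C), t)"
proof transfer
  fix X :: "(real^2) \<times> real" and u t A B C
  assume h: "proportional X (u, t)"
  let ?f = "\<lambda>(u :: real^2, t :: real). (t *\<^sub>R centroid A B C - (1 / 2) *\<^sub>R (u - t *\<^sub>R centroid A B C), t)"
  have "proportional (?f X) (?f (u, t))"
    using complement.rsp h unfolding rel_fun_def by blast
  then show "proportional (?f X)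
     (t *\<^sub>R centroid A B C - (1 / 2) *\<^sub>R (u - t *\<^sub>R centroid A B C), t)" by simp
qed

context nondegenerate_triangle
begin

lemma isotomic_bpt:
  assumes "x * y * z \<noteq> 0"
  shows "isotomic A B C (bpt x y z) = bpt (y * z) (z * x) (x * y)"
  unfolding isotomic_def
proof (rule the_equality)
  have nz: "(x, y, z) \<noteq> (0, 0, 0)" "(y * z, z * x, x * y) \<noteq> (0, 0, 0)" using assms by auto
  then show "\<exists>x' y' z'. has_barycentric A B C (bpt x y z) x' y' z' \<and>
     has_barycentric A B C (bpt (y * z) (z * x) (x * y)) (y' * z') (z' * x') (x' * y')"
    unfolding has_barycentric_bpt by blast
  fix Y
  assume "\<exists>x' y' z'. has_barycentric A B C (bpt x y z) x' y' z' \<and>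
     has_barycentric A B C Y (y' * z') (z' * x') (x' * y')"
  then obtain x' y' z' where nz': "(x', y', z') \<noteq> (0, 0, 0)" and eq: "bpt x y z = bpt x' y' z'"
    and Y: "Y = bpt (y' * z') (z' * x') (x' * y')"
    unfolding has_barycentric_bpt by blast
  from eq obtain k where k: "k \<noteq> 0" "x' = k * x" "y' = k * y" "z' = k * z"
    unfolding bpt_eq_iff[OF nz(1) nz'] by blast
  have "Y = bpt (k * k * (y * z)) (k * k * (z * x)) (k * k * (x * y))"
    unfolding Y k by (simp add: mult_ac)
  with k(1) show "Y = bpt (y * z) (z * x) (x * y)" by (simp only: bpt_scale mult_eq_0_iff simp_thms)
qed

lemma complement_bpt:
  assumes "(x, y, z) \<noteq> (0, 0, 0)"
  shows "complement A B C (bpt x y z) = bpt (y + z) (z + x) (x + y)"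
proof -
  obtain u t where ut: "bv x y z = (u, t)" by (cases "bv x y z")
  then have u: "u = x *\<^sub>R A + y *\<^sub>R B + z *\<^sub>R C" and t: "t = x + y + z"
    by (simp_all add: bary_vec_def)
  have "t *\<^sub>R centroid A B C - (1/2) *\<^sub>R (u - t *\<^sub>R centroid A B C)
      = (3/2 * t) *\<^sub>R centroid A B C - (1/2) *\<^sub>R u"
    by (simp add: algebra_simps flip: scaleR_add_left)
  also have "\<dots> = (t / 2) *\<^sub>R (A + B + C) - (1/2) *\<^sub>R u" by (simp add: centroid_def)
  also have "\<dots> = (1/2) *\<^sub>R ((y + z) *\<^sub>R A + (z + x) *\<^sub>R B + (x + y) *\<^sub>R C)"
    unfolding u t by (simp add: algebra_simps add_divide_distrib)
  finally have e: "t *\<^sub>R centroid A B C - (1/2) *\<^sub>R (u - t *\<^sub>R centroid A B C)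
      = (1/2) *\<^sub>R ((y + z) *\<^sub>R A + (z + x) *\<^sub>R B + (x + y) *\<^sub>R C)" .
  have "(1/2) *\<^sub>R bv (y + z) (z + x) (x + y) =
      ((1/2) *\<^sub>R ((y + z) *\<^sub>R A + (z + x) *\<^sub>R B + (x + y) *\<^sub>R C), t)"
    by (simp add: bary_vec_def t)
  then have "has_coords (complement A B C (bpt x y z)) ((1/2) *\<^sub>R bv (y + z) (z + x) (x + y))"
    using has_coords_complement[OF has_coords_bpt[OF assms, unfolded ut], of A B C] unfolding e
    by simp
  then show ?thesis
    unfolding bary_vec_scale by (simp only: has_barycentric_bpt bpt_scale flip: has_barycentric_iff)
qed

lemma isotomcomplement_bpt:
  assumes "x * y * z \<noteq> 0"
  shows "isotomcomplement A B C (bpt x y z) = bpt (x * (y + z)) (y * (z + x)) (z * (x + y))"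
proof -
  have "(y * z, z * x, x * y) \<noteq> (0, 0, 0)" using assms by auto
  then show ?thesis
    unfolding isotomcomplement_def isotomic_bpt[OF assms]
    by (subst complement_bpt) (simp_all add: distrib_left mult_ac add_ac)
qed

text \<open>The point at infinity of \<open>QD\<close> is \<open>(\<dots> : p2 (s - p3\<^sup>2) : p3 (s - p2\<^sup>2))\<close>. Its last two
  coordinates do not both vanish: \<open>s = p2\<^sup>2 = p3\<^sup>2\<close> would force \<open>p2 = p3\<close>, as \<open>p2 + p3 \<noteq> 0\<close>, and then
  \<open>s = p2\<^sup>2 + 2 p1 p2\<close> would force \<open>p1 p2 = 0\<close>.\<close>
lemma parallel_cevian_A:
  assumes p: "p1 * p2 * p3 \<noteq> 0" "p2 + p3 \<noteq> 0"
    and s: "s = p2 * p3 + p3 * p1 + p1 * p2"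
  defines "Q \<equiv> bpt (p1 * (p2 + p3)) (p2 * (p3 + p1)) (p3 * (p1 + p2))"
    and "D \<equiv> meet (join (ordinary A) (bpt p1 p2 p3)) (join (ordinary B) (ordinary C))"
  shows "(p3 * (s - p2\<^sup>2), p2 * (s - p3\<^sup>2)) \<noteq> (0, 0)"
    and "parallel_through (ordinary A) (join Q D) = bln 0 (- (p3 * (s - p2\<^sup>2))) (p2 * (s - p3\<^sup>2))"
proof -
  let ?d2 = "p2 * (s - p3\<^sup>2)" and ?d3 = "p3 * (s - p2\<^sup>2)"
  have nz: "p1 \<noteq> 0" "p2 \<noteq> 0" "p3 \<noteq> 0" using p by auto
  show d: "(?d3, ?d2) \<noteq> (0, 0)"
  proof
    assume "(?d3, ?d2) = (0, 0)"
    with nz have e: "s = p2\<^sup>2" "s = p3\<^sup>2" by auto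
    then have "(p2 - p3) * (p2 + p3) = 0" by (simp add: power2_eq_square algebra_simps)
    with p(2) have "p2 = p3" by simp
    with s e nz show False by (simp add: power2_eq_square)
  qed
  let ?l = "p2 * (p3 + p1) * p3 - p3 * (p1 + p2) * p2" and ?m = "- (p1 * (p2 + p3) * p3)"
    and ?n = "p1 * (p2 + p3) * p2"
  have D: "D = bpt 0 p2 p3"
    unfolding D_def side_A using nz
    by (subst cevian_A) (simp, subst meet_bln, auto)
  have QD: "join Q D = bln ?l ?m ?n"
    unfolding D Q_def using nz p(2) by (subst join_bpt) auto
  have 2: "?n * 1 - ?l * 1 = ?d2" and 3: "?l * 1 - ?m * 1 = ?d3"
    unfolding s by (simp_all add: power2_eq_square algebra_simps)
  have "meet (join Q D) line_at_infinity = bpt (?m * 1 - ?n * 1) ?d2 ?d3"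
    unfolding QD line_at_infinity_bln
    by (subst meet_bln) (unfold 2 3, use d in auto)
  then show "parallel_through (ordinary A) (join Q D) = bln 0 (- ?d3) ?d2"
    unfolding parallel_through_def using d by (simp only: cevian_A prod.inject)
       (subst cevian_A, auto)
qed

text \<open>The coordinates \<open>p1 / (p1\<^sup>2 - s)\<close>, \<open>\<dots>\<close> are cleared of denominators, so that the formula remains
  valid when \<open>H\<close> is a vertex.\<close>
lemma generalized_orthocenter_bpt:
  assumes p: "p1 * p2 * p3 \<noteq> 0" "p2 + p3 \<noteq> 0" "p3 + p1 \<noteq> 0" "p1 + p2 \<noteq> 0"
    and s: "s = p2 * p3 + p3 * p1 + p1 * p2"
  shows "(p1 * ((p2\<^sup>2 - s) * (p3\<^sup>2 - s)), p2 * ((p3\<^sup>2 - s) * (p1\<^sup>2 - s)),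
      p3 * ((p1\<^sup>2 - s) * (p2\<^sup>2 - s))) \<noteq> (0, 0, 0)" (is ?nz)
    and "generalized_orthocenter A B C (bpt p1 p2 p3) =
    bpt (p1 * ((p2\<^sup>2 - s) * (p3\<^sup>2 - s))) (p2 * ((p3\<^sup>2 - s) * (p1\<^sup>2 - s)))
      (p3 * ((p1\<^sup>2 - s) * (p2\<^sup>2 - s)))"
proof -
  interpret BCA: nondegenerate_triangle B C A by (rule cyclic)
  interpret CAB: nondegenerate_triangle C A B by (rule BCA.cyclic)
  have p': "p2 * p3 * p1 \<noteq> 0" "p3 * p1 * p2 \<noteq> 0"
    and s': "s = p3 * p1 + p1 * p2 + p2 * p3" "s = p1 * p2 + p2 * p3 + p3 * p1"
    using p(1) s by simp_all
  note cyc = bary_point_cyclic[of B C A] bary_point_cyclic[of A B C, symmetric]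
    bary_line_cyclic[of B C A] bary_line_cyclic[of A B C, symmetric]
  note 1 = parallel_cevian_A[OF p(1,2) s]
  note 2 = BCA.parallel_cevian_A[OF p'(1) p(3) s'(1), unfolded cyc]
  note 3 = CAB.parallel_cevian_A[OF p'(2) p(4) s'(2), unfolded cyc]
  have nz: "p1 \<noteq> 0" "p2 \<noteq> 0" "p3 \<noteq> 0" using p by auto
  show ?nz using 1(1) 2(1) 3(1) nz by auto
  then show "generalized_orthocenter A B C (bpt p1 p2 p3) =
    bpt (p1 * ((p2\<^sup>2 - s) * (p3\<^sup>2 - s))) (p2 * ((p3\<^sup>2 - s) * (p1\<^sup>2 - s)))
      (p3 * ((p1\<^sup>2 - s) * (p2\<^sup>2 - s)))"
    unfolding generalized_orthocenter_def cevian_triangle_def Let_def prod.case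
      isotomcomplement_bpt[OF p(1)] 1(2) 2(2) 3(2)
    by (intro common_point_cevians) (use 1(1) 2(1) 3(1) in \<open>auto simp: algebra_simps\<close>)
qed

end

section \<open>Isogonal conjugation in barycentric coordinates\<close>

lemma has_coords_reflection:
  "has_coords X (u, t) \<Longrightarrow>
    has_coords (reflection V n X) (u - (2 * (((u - t *\<^sub>R V) \<bullet> n) / (n \<bullet> n))) *\<^sub>R n, t)"
proof transfer
  fix X :: "(real^2) \<times> real" and u t V n
  assume h: "proportional X (u, t)"
  let ?f = "\<lambda>(u :: real^2, t :: real). (u - (2 * (((u - t *\<^sub>R V) \<bullet> n) / (n \<bullet> n))) *\<^sub>R n, t)"
  have "proportional (?f X) (?f (u, t))"
    using reflection.rsp h unfolding rel_fun_def by blast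
  then show "proportional (?f X)
     (u - (2 * (((u - t *\<^sub>R V) \<bullet> n) / (n \<bullet> n))) *\<^sub>R n, t)" by simp
qed

text \<open>The reflection with normal \<open>sgn v - sgn w\<close> interchanges the unit vectors \<open>sgn v\<close> and \<open>sgn w\<close>.\<close>
lemma sgn_reflection:
  fixes v w :: "'a :: real_inner"
  assumes "v \<noteq> 0" "w \<noteq> 0" and n: "n = sgn v - sgn w" "n \<noteq> 0"
  shows "y *\<^sub>R v + z *\<^sub>R w - (2 * (((y *\<^sub>R v + z *\<^sub>R w) \<bullet> n) / (n \<bullet> n))) *\<^sub>R n =
    (z * norm w / norm v) *\<^sub>R v + (y * norm v / norm w) *\<^sub>R w"
proof -
  define e where "e = sgn v"
  define f where "f = sgn w"
  have v: "v = norm v *\<^sub>R e" and w: "w = norm w *\<^sub>R f"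
    using assms by (simp_all add: e_def f_def sgn_div_norm)
  have "norm e = 1" "norm f = 1" using assms by (simp_all add: e_def f_def norm_sgn)
  then have ee: "e \<bullet> e = 1" and ff: "f \<bullet> f = 1" by (simp_all add: norm_eq_1)
  have nef: "n = e - f" using n by (simp add: e_def f_def)
  have nn: "n \<bullet> n = 2 * (1 - e \<bullet> f)"
    unfolding nef by (simp add: inner_diff_left inner_diff_right ee ff inner_commute[of f e])
  define k where "k = 1 - e \<bullet> f"
  have nz: "k \<noteq> 0" using n(2) nn by (auto simp: k_def)
  define c where "c = norm v"
  define b where "b = norm w"
  have cb: "c \<noteq> 0" "b \<noteq> 0" using assms by (simp_all add: c_def b_def)
  have "(y *\<^sub>R v + z *\<^sub>R w) \<bullet> n = (y * c - z * b) * (1 - e \<bullet> f)"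
    unfolding nef by (subst v, subst w)
      (simp add: inner_diff_right inner_add_left ee ff inner_commute[of f e] c_def b_def algebra_simps)
  then have "2 * (((y *\<^sub>R v + z *\<^sub>R w) \<bullet> n) / (n \<bullet> n)) = y * c - z * b"
    using nz unfolding nn k_def[symmetric] by simp
  moreover have "y *\<^sub>R v + z *\<^sub>R w - (y * c - z * b) *\<^sub>R n = (z * b) *\<^sub>R e + (y * c) *\<^sub>R f"
    unfolding nef by (subst v, subst w) (simp add: c_def b_def algebra_simps)
  moreover have "(z * b) *\<^sub>R e = (z * b / c) *\<^sub>R v" "(y * c) *\<^sub>R f = (y * c / b) *\<^sub>R w"
    using cb by (subst v w, simp add: c_def b_def)+
  ultimately show ?thesis by (simp add: b_def c_def)
qed

context nondegenerate_triangle
begin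

lemma reflection_bpt:
  defines "b \<equiv> dist C A" and "c \<equiv> dist A B"
  assumes "(x, y, z) \<noteq> (0, 0, 0)"
  shows "reflection A (sgn (B - A) - sgn (C - A)) (bpt x y z) =
    bpt (x + y + z - z * b / c - y * c / b) (z * b / c) (y * c / b)"
proof -
  have ne: "B - A \<noteq> 0" "C - A \<noteq> 0" using vertices_distinct by auto
  have cn: "c = norm (B - A)" "b = norm (C - A)"
    by (simp_all add: b_def c_def dist_norm norm_minus_commute)
  then have cb: "c \<noteq> 0" "b \<noteq> 0" using ne by auto
  define n where "n = sgn (B - A) - sgn (C - A)"
  have n0: "n \<noteq> 0"
  proof
    assume "n = 0"
    then have "(1 / c) *\<^sub>R (B - A) - (1 / b) *\<^sub>R (C - A) = 0"
      by (simp add: n_def cn sgn_div_norm divide_inverse)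
    then have "bv (1 / b - 1 / c) (1 / c) (- (1 / b)) = 0"
      by (simp add: bary_vec_def zero_prod_def algebra_simps)
    with cb show False unfolding bary_vec_eq_0 by simp
  qed
  obtain u t where ut: "bv x y z = (u, t)" by (cases "bv x y z")
  then have u: "u = x *\<^sub>R A + y *\<^sub>R B + z *\<^sub>R C" and t: "t = x + y + z"
    by (simp_all add: bary_vec_def)
  have w: "u - t *\<^sub>R A = y *\<^sub>R (B - A) + z *\<^sub>R (C - A)"
    unfolding u t by (simp add: algebra_simps)
  have "u - (2 * (((u - t *\<^sub>R A) \<bullet> n) / (n \<bullet> n))) *\<^sub>R n =
     t *\<^sub>R A + ((u - t *\<^sub>R A) - (2 * (((u - t *\<^sub>R A) \<bullet> n) / (n \<bullet> n))) *\<^sub>R n)"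
    by simp
  also have "\<dots> = t *\<^sub>R A + ((z * b / c) *\<^sub>R (B - A) + (y * c / b) *\<^sub>R (C - A))"
    unfolding w sgn_reflection[OF ne n_def n0] cn ..
  finally have e: "u - (2 * (((u - t *\<^sub>R A) \<bullet> n) / (n \<bullet> n))) *\<^sub>R n =
    t *\<^sub>R A + ((z * b / c) *\<^sub>R (B - A) + (y * c / b) *\<^sub>R (C - A))" .
  have "has_coords (reflection A n (bpt x y z))
      (bv (x + y + z - z * b / c - y * c / b) (z * b / c) (y * c / b))"
    using has_coords_reflection[OF has_coords_bpt[OF assms(3), unfolded ut], of A n] unfolding e
    by (simp add: bary_vec_def t algebra_simps)
  then show ?thesis
    by (simp only: has_barycentric_bpt n_def flip: has_barycentric_iff)
qed

text \<open>On the ratio \<open>y : z\<close>, which determines a line through \<open>A\<close>, the reflection in the bisector acts by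
  \<open>(y : z) \<mapsto> (b\<^sup>2 z : c\<^sup>2 y)\<close>. It is an involution, so the preimage of a point of the image line is
  the reflection of that point.\<close>
lemma isogonal_line_bpt:
  assumes "(y, z) \<noteq> (0, 0)"
  shows "isogonal_line B A C (bpt x y z) = bln 0 ((dist A B)\<^sup>2 * y) (- ((dist C A)\<^sup>2 * z))"
proof -
  define b where "b = dist C A"
  define c where "c = dist A B"
  have cb: "c \<noteq> 0" "b \<noteq> 0" using vertices_distinct by (auto simp: b_def c_def)
  define r where "r = reflection A (sgn (B - A) - sgn (C - A))"
  have r: "r (bpt x' y' z') = bpt (x' + y' + z' - z' * b / c - y' * c / b) (z' * b / c) (y' * c / b)"
    if "(x', y', z') \<noteq> (0, 0, 0)" for x' y' z'
    unfolding r_def b_def c_def using that by (rule reflection_bpt)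
  have rnz: "(x' + y' + z' - z' * b / c - y' * c / b, z' * b / c, y' * c / b) \<noteq> (0, 0, 0)"
    if "(x', y', z') \<noteq> (0, 0, 0)" for x' y' z'
    using that cb by auto
  have "r ` bln 0 (- z) y = bln 0 (c\<^sup>2 * y) (- (b\<^sup>2 * z))"
  proof (rule bln_eqI)
    fix x' y' z' :: real
    assume nz: "(x', y', z') \<noteq> (0, 0, 0)"
    show "bpt x' y' z' \<in> r ` bln 0 (- z) y \<longleftrightarrow> 0 * x' + c\<^sup>2 * y * y' + - (b\<^sup>2 * z) * z' = 0"
    proof
      assume "bpt x' y' z' \<in> r ` bln 0 (- z) y"
      then obtain X where X: "X \<in> bln 0 (- z) y" and rX: "bpt x' y' z' = r X" by blast
      obtain x'' y'' z'' where nz'': "(x'', y'', z'') \<noteq> (0, 0, 0)" and Xe: "X = bpt x'' y'' z''"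
        by (rule bpt_cases)
      from X have e: "y * z'' = z * y''" unfolding Xe bpt_in_bln[OF nz''] by simp
      from rX obtain k where "y' = k * (z'' * b / c)" "z' = k * (y'' * c / b)"
        unfolding Xe r[OF nz''] eq_commute[of "bpt x' y' z'"] bpt_eq_iff[OF rnz[OF nz''] nz] by blast
      then have "c\<^sup>2 * y * y' - b\<^sup>2 * z * z' = k * b * c * (y * z'' - z * y'')"
        using cb by (simp add: power2_eq_square algebra_simps)
      with e show "0 * x' + c\<^sup>2 * y * y' + - (b\<^sup>2 * z) * z' = 0" by simp
    next
      assume e: "0 * x' + c\<^sup>2 * y * y' + - (b\<^sup>2 * z) * z' = 0"
      let ?X = "bpt (x' + y' + z' - z' * b / c - y' * c / b) (z' * b / c) (y' * c / b)"
      have "b * c * (y * (y' * c / b) - z * (z' * b / c)) = 0"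
        using e cb by (simp add: power2_eq_square algebra_simps)
      then have "?X \<in> bln 0 (- z) y"
        unfolding bpt_in_bln[OF rnz[OF nz]] using cb by simp
      moreover have "r ?X = bpt x' y' z'"
        unfolding r[OF rnz[OF nz]] using cb by simp
      ultimately show "bpt x' y' z' \<in> r ` bln 0 (- z) y" by (metis imageI)
    qed
  qed
  then show ?thesis
    unfolding isogonal_line_def cevian_A[OF assms] by (simp add: r_def b_def c_def)
qed

lemma isogonal_bpt:
  assumes "x * y * z \<noteq> 0"
  shows "isogonal A B C (bpt x y z) =
    bpt ((dist B C)\<^sup>2 * (y * z)) ((dist C A)\<^sup>2 * (z * x)) ((dist A B)\<^sup>2 * (x * y))"
proof -
  interpret BCA: nondegenerate_triangle B C A by (rule cyclic)
  interpret CAB: nondegenerate_triangle C A B by (rule BCA.cyclic)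
  have d: "(dist B C)\<^sup>2 \<noteq> 0" "(dist C A)\<^sup>2 \<noteq> 0" "(dist A B)\<^sup>2 \<noteq> 0"
    using vertices_distinct by auto
  have 1: "isogonal_line B A C (bpt x y z) = bln 0 ((dist A B)\<^sup>2 * y) (- ((dist C A)\<^sup>2 * z))"
    using assms by (intro isogonal_line_bpt) auto
  have "isogonal_line C B A (bary_point B C A y z x) =
      bary_line B C A 0 ((dist B C)\<^sup>2 * z) (- ((dist A B)\<^sup>2 * x))"
    using assms by (intro BCA.isogonal_line_bpt) auto
  then have 2: "isogonal_line C B A (bpt x y z) = bln (- ((dist A B)\<^sup>2 * x)) 0 ((dist B C)\<^sup>2 * z)"
    unfolding bary_point_cyclic[of B C A] bary_line_cyclic[of B C A] .
  have "isogonal_line A C B (bary_point C A B z x y) =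
      bary_line C A B 0 ((dist C A)\<^sup>2 * x) (- ((dist B C)\<^sup>2 * y))"
    using assms by (intro CAB.isogonal_line_bpt) auto
  then have 3: "isogonal_line A C B (bpt x y z) = bln ((dist C A)\<^sup>2 * x) (- ((dist B C)\<^sup>2 * y)) 0"
    unfolding bary_point_cyclic[of A B C, symmetric] bary_line_cyclic[of A B C, symmetric] .
  show ?thesis
    unfolding isogonal_def 1 2 3
    by (rule common_point_cevians) (use d assms in \<open>auto simp: algebra_simps\<close>)
qed


text \<open>With \<open>H = (h1 : h2 : h3)\<close>, the products \<open>h2 h3\<close>, \<open>h3 h1\<close>, \<open>h1 h2\<close> share the factor
  \<open>(p1\<^sup>2 - s) (p2\<^sup>2 - s) (p3\<^sup>2 - s)\<close>. It is nonzero because each of its factors vanishes only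
  when \<open>H\<close> is the corresponding vertex.\<close>
lemma isogonal_generalized_orthocenter:
  assumes p: "p1 * p2 * p3 \<noteq> 0" "p2 + p3 \<noteq> 0" "p3 + p1 \<noteq> 0" "p1 + p2 \<noteq> 0"
    and s: "s = p2 * p3 + p3 * p1 + p1 * p2"
  defines "H \<equiv> generalized_orthocenter A B C (bpt p1 p2 p3)"
  assumes H: "H \<noteq> ordinary A" "H \<noteq> ordinary B" "H \<noteq> ordinary C"
  shows "s \<noteq> p1\<^sup>2" "isogonal A B C H = bpt ((dist B C)\<^sup>2 * (p2 * p3 * (s - p1\<^sup>2)))
    ((dist C A)\<^sup>2 * (p3 * p1 * (s - p2\<^sup>2))) ((dist A B)\<^sup>2 * (p1 * p2 * (s - p3\<^sup>2)))"
proof -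
  let ?a = "p1\<^sup>2 - s" and ?b = "p2\<^sup>2 - s" and ?c = "p3\<^sup>2 - s"
  note orth = generalized_orthocenter_bpt[OF p s]
  have Hb: "H = bpt (p1 * (?b * ?c)) (p2 * (?c * ?a)) (p3 * (?a * ?b))"
    unfolding H_def by (rule orth(2))
  have "?a \<noteq> 0"
  proof
    assume "?a = 0"
    then have "H = ordinary A" unfolding Hb ordinary_vertices using orth(1) by (intro bpt_eqI orth(1)) auto
    with H show False by simp
  qed
  moreover have "?b \<noteq> 0"
  proof
    assume "?b = 0"
    then have "H = ordinary B" unfolding Hb ordinary_vertices using orth(1) by (intro bpt_eqI orth(1)) auto
    with H show False by simp
  qed
  moreover have "?c \<noteq> 0"
  proof
    assume "?c = 0"
    then have "H = ordinary C" unfolding Hb ordinary_vertices using orth(1) by (intro bpt_eqI orth(1)) auto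
    with H show False by simp
  qed
  ultimately have k: "- (?a * ?b * ?c) \<noteq> 0" and h: "p1 * (?b * ?c) * (p2 * (?c * ?a)) * (p3 * (?a * ?b)) \<noteq> 0"
    using p(1) by simp_all
  show "s \<noteq> p1\<^sup>2" using \<open>?a \<noteq> 0\<close> by simp
  have "isogonal A B C H = bpt (- (?a * ?b * ?c) * ((dist B C)\<^sup>2 * (p2 * p3 * (s - p1\<^sup>2))))
    (- (?a * ?b * ?c) * ((dist C A)\<^sup>2 * (p3 * p1 * (s - p2\<^sup>2))))
    (- (?a * ?b * ?c) * ((dist A B)\<^sup>2 * (p1 * p2 * (s - p3\<^sup>2))))"
    unfolding Hb isogonal_bpt[OF h]
    unfolding minus_diff_eq[of "p1\<^sup>2" s, symmetric] minus_diff_eq[of "p2\<^sup>2" s, symmetric]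
      minus_diff_eq[of "p3\<^sup>2" s, symmetric]
    by (simp only: mult_minus_left mult_minus_right minus_minus mult_ac)
  then show "isogonal A B C H = bpt ((dist B C)\<^sup>2 * (p2 * p3 * (s - p1\<^sup>2)))
    ((dist C A)\<^sup>2 * (p3 * p1 * (s - p2\<^sup>2))) ((dist A B)\<^sup>2 * (p1 * p2 * (s - p3\<^sup>2)))"
    unfolding bpt_scale[OF k] .
qed


end

section \<open>The circumcircle, its tangents and second intersections\<close>

lemma circumcircle_cyclic: "circumcircle B C A = circumcircle A B C"
proof -
  have "B \<in> S \<and> C \<in> S \<and> A \<in> S \<longleftrightarrow> A \<in> S \<and> B \<in> S \<and> C \<in> S" for S by blast
  then show ?thesis by (simp only: circumcircle_def)
qed

context nondegenerate_triangle
begin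

text \<open>The power of a point with respect to the circle around the vertices, in homogeneous form. At points
  at infinity (\<open>t = 0\<close>) the left-hand side is \<open>(norm u)\<^sup>2\<close>, so the equation of the circumcircle has
  no solutions there.\<close>
lemma power_of_point:
  assumes M: "dist A M = r" "dist B M = r" "dist C M = r" and ut: "bv x y z = (u, t)"
  shows "(norm (u - t *\<^sub>R M))\<^sup>2 =
    t\<^sup>2 * r\<^sup>2 - ((dist B C)\<^sup>2 * (y * z) + (dist C A)\<^sup>2 * (z * x) + (dist A B)\<^sup>2 * (x * y))"
proof -
  define a b c where "a = A - M" and "b = B - M" and "c = C - M"
  have u: "u - t *\<^sub>R M = x *\<^sub>R a + y *\<^sub>R b + z *\<^sub>R c" and t: "t = x + y + z"
    using ut by (auto simp: bary_vec_def a_def b_def c_def algebra_simps)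
  have r: "a \<bullet> a = r\<^sup>2" "b \<bullet> b = r\<^sup>2" "c \<bullet> c = r\<^sup>2"
    unfolding a_def b_def c_def dot_square_norm using M by (simp_all add: dist_norm)
  have "dist B C = norm (b - c)" "dist C A = norm (c - a)" "dist A B = norm (a - b)"
    by (simp_all add: a_def b_def c_def dist_norm)
  then have d: "(dist B C)\<^sup>2 = 2 * r\<^sup>2 - 2 * (b \<bullet> c)" "(dist C A)\<^sup>2 = 2 * r\<^sup>2 - 2 * (a \<bullet> c)"
    "(dist A B)\<^sup>2 = 2 * r\<^sup>2 - 2 * (a \<bullet> b)"
    by (simp_all add: power2_norm_eq_inner inner_diff_left inner_diff_right r inner_commute)
  have "(norm (u - t *\<^sub>R M))\<^sup>2 = (x\<^sup>2 + y\<^sup>2 + z\<^sup>2) * r\<^sup>2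
      + 2 * (x * y * (a \<bullet> b) + x * z * (a \<bullet> c) + y * z * (b \<bullet> c))"
    unfolding u power2_norm_eq_inner inner_add_left inner_add_right inner_scaleR_left
      inner_scaleR_right r inner_commute[of b a] inner_commute[of c a] inner_commute[of c b]
    by (simp add: power2_eq_square algebra_simps)
  then show ?thesis
    unfolding d t by (simp add: power2_eq_square algebra_simps)
qed

lemma ex_circumcenter: "\<exists>M r. dist A M = r \<and> dist B M = r \<and> dist C M = r"
proof -
  let ?b1 = "B$1 - A$1" and ?b2 = "B$2 - A$2" and ?c1 = "C$1 - A$1" and ?c2 = "C$2 - A$2"
  let ?d = "?b1 * ?c2 - ?b2 * ?c1"
  define \<beta> where "\<beta> = ((B - A) \<bullet> (B - A)) / 2"
  define \<gamma> where "\<gamma> = ((C - A) \<bullet> (C - A)) / 2"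
  \<comment> \<open>The circumcenter relative to \<open>A\<close>, from Cramer's rule for \<open>(B - A) \<bullet> w = \<beta>\<close> and
    \<open>(C - A) \<bullet> w = \<gamma>\<close>, the equations of two perpendicular bisectors.\<close>
  define w :: "real^2" where "w = vector [(\<beta> * ?c2 - \<gamma> * ?b2) / ?d, (?b1 * \<gamma> - ?c1 * \<beta>) / ?d]"
  have w: "w$1 = (\<beta> * ?c2 - \<gamma> * ?b2) / ?d" "w$2 = (?b1 * \<gamma> - ?c1 * \<beta>) / ?d"
    by (simp_all add: w_def)
  have "?b1 * (\<beta> * ?c2 - \<gamma> * ?b2) + ?b2 * (?b1 * \<gamma> - ?c1 * \<beta>) = \<beta> * ?d"
    "?c1 * (\<beta> * ?c2 - \<gamma> * ?b2) + ?c2 * (?b1 * \<gamma> - ?c1 * \<beta>) = \<gamma> * ?d"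
    by (simp_all add: algebra_simps)
  then have "?b1 * w$1 + ?b2 * w$2 = \<beta>" "?c1 * w$1 + ?c2 * w$2 = \<gamma>"
    unfolding w times_divide_eq_right add_divide_distrib[symmetric]
    using area_nonzero by (simp_all only: nonzero_mult_div_cancel_right simp_thms)
  then have ip: "(B - A) \<bullet> w = \<beta>" "(C - A) \<bullet> w = \<gamma>"
    by (simp_all add: inner_vec_def sum_2)
  have "norm ((B - A) - w) = norm w" "norm ((C - A) - w) = norm w"
    using ip by (simp_all add: norm_eq \<beta>_def \<gamma>_def inner_diff_left inner_diff_right inner_commute)
  then have "dist A (A + w) = norm w \<and> dist B (A + w) = norm w \<and> dist C (A + w) = norm w"
    by (simp add: dist_norm diff_diff_eq)
  then show ?thesis by blast
qed

lemma in_sphere_iff: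
  assumes M: "dist A M = r" "dist B M = r" "dist C M = r" and "x + y + z = 1"
  shows "x *\<^sub>R A + y *\<^sub>R B + z *\<^sub>R C \<in> sphere M r \<longleftrightarrow>
    (dist B C)\<^sup>2 * (y * z) + (dist C A)\<^sup>2 * (z * x) + (dist A B)\<^sup>2 * (x * y) = 0"
proof -
  have "r \<ge> 0" using M(1) by auto
  have "bv x y z = (x *\<^sub>R A + y *\<^sub>R B + z *\<^sub>R C, 1)"
    using assms(4) by (simp add: bary_vec_def)
  from power_of_point[OF M this]
  have "(dist M (x *\<^sub>R A + y *\<^sub>R B + z *\<^sub>R C))\<^sup>2 = r\<^sup>2 -
    ((dist B C)\<^sup>2 * (y * z) + (dist C A)\<^sup>2 * (z * x) + (dist A B)\<^sup>2 * (x * y))"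
    by (simp add: dist_norm norm_minus_commute)
  moreover have "x *\<^sub>R A + y *\<^sub>R B + z *\<^sub>R C \<in> sphere M r \<longleftrightarrow>
      (dist M (x *\<^sub>R A + y *\<^sub>R B + z *\<^sub>R C))\<^sup>2 = r\<^sup>2"
    unfolding mem_sphere using \<open>r \<ge> 0\<close> by (intro power2_eq_iff_nonneg[symmetric]) simp_all
  ultimately show ?thesis by linarith
qed

lemma plane_cases:
  obtains x y z where "x + y + z = 1" "p = x *\<^sub>R A + y *\<^sub>R B + z *\<^sub>R C"
proof -
  obtain x y z where "(p, 1) = bv x y z" using bary_vec_surj by blast
  then have "x + y + z = 1" "p = x *\<^sub>R A + y *\<^sub>R B + z *\<^sub>R C" by (simp_all add: bary_vec_def)
  then show ?thesis by (rule that)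
qed

lemma circumcircle_sphere:
  obtains M r where "dist A M = r" "dist B M = r" "dist C M = r" "circumcircle A B C = sphere M r"
proof -
  obtain M r where M: "dist A M = r" "dist B M = r" "dist C M = r"
    using ex_circumcenter by blast
  have "circumcircle A B C = sphere M r"
    unfolding circumcircle_def
  proof (rule the_equality)
    show "(\<exists>z r'. sphere M r = sphere z r') \<and> A \<in> sphere M r \<and> B \<in> sphere M r \<and> C \<in> sphere M r"
      using M by (auto simp: dist_commute)
  next
    fix S assume "(\<exists>z r. S = sphere z r) \<and> A \<in> S \<and> B \<in> S \<and> C \<in> S"
    then obtain M' r' where S: "S = sphere M' r'"
      and M': "dist A M' = r'" "dist B M' = r'" "dist C M' = r'"
      by (auto simp: dist_commute)
    show "S = sphere M r"
    proof (rule set_eqI)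
      fix p
      obtain x y z where "x + y + z = 1" "p = x *\<^sub>R A + y *\<^sub>R B + z *\<^sub>R C" by (rule plane_cases)
      then show "p \<in> S \<longleftrightarrow> p \<in> sphere M r"
        unfolding S using in_sphere_iff[OF M] in_sphere_iff[OF M'] by metis
    qed
  qed
  with M that show ?thesis by blast
qed

lemma bpt_in_circumcircle:
  assumes nz: "(x, y, z) \<noteq> (0, 0, 0)"
  shows "bpt x y z \<in> ordinary ` circumcircle A B C \<longleftrightarrow>
    (dist B C)\<^sup>2 * (y * z) + (dist C A)\<^sup>2 * (z * x) + (dist A B)\<^sup>2 * (x * y) = 0"
    (is "_ \<longleftrightarrow> ?f x y z = 0")
proof -
  obtain M r where M: "dist A M = r" "dist B M = r" "dist C M = r"
    and S: "circumcircle A B C = sphere M r" by (rule circumcircle_sphere)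
  have scale: "?f (k * x) (k * y) (k * z) = k * k * ?f x y z" for k x y z
    by (simp add: algebra_simps)
  show ?thesis
  proof
    assume "bpt x y z \<in> ordinary ` circumcircle A B C"
    then obtain p where p: "p \<in> sphere M r" "bpt x y z = ordinary p" unfolding S by blast
    obtain x' y' z' where 1: "x' + y' + z' = 1" and pe: "p = x' *\<^sub>R A + y' *\<^sub>R B + z' *\<^sub>R C"
      by (rule plane_cases)
    then have nz': "(x', y', z') \<noteq> (0, 0, 0)" by auto
    have f: "?f x' y' z' = 0" using p(1) unfolding pe in_sphere_iff[OF M 1] .
    have "bpt x' y' z' = bpt x y z" using p(2) ordinary_bpt[OF 1] pe by simp
    then obtain k where "x = k * x'" "y = k * y'" "z = k * z'"
      unfolding bpt_eq_iff[OF nz' nz] by blast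
    then have "?f x y z = k * k * ?f x' y' z'" using scale by simp
    with f show "?f x y z = 0" by simp
  next
    assume f: "?f x y z = 0"
    obtain u t where ut: "bv x y z = (u, t)" by (cases "bv x y z")
    then have t: "t = x + y + z" by (simp add: bary_vec_def)
    have "t \<noteq> 0"
    proof
      assume "t = 0"
      with power_of_point[OF M ut] f have "u = 0" by simp
      with \<open>t = 0\<close> ut have "bv x y z = 0" by (simp add: zero_prod_def)
      with nz show False unfolding bary_vec_eq_0 by simp
    qed
    define k where "k = 1 / t"
    have k: "k \<noteq> 0" using \<open>t \<noteq> 0\<close> by (simp add: k_def)
    have 1: "k * x + k * y + k * z = 1"
      using \<open>t \<noteq> 0\<close> unfolding distrib_left[symmetric] t[symmetric] k_def by simp
    have "?f (k * x) (k * y) (k * z) = 0" unfolding scale f by simp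
    then have "(k * x) *\<^sub>R A + (k * y) *\<^sub>R B + (k * z) *\<^sub>R C \<in> circumcircle A B C"
      unfolding S in_sphere_iff[OF M 1] .
    then have "bpt (k * x) (k * y) (k * z) \<in> ordinary ` circumcircle A B C"
      unfolding ordinary_bpt[OF 1, symmetric] by (rule imageI)
    then show "bpt x y z \<in> ordinary ` circumcircle A B C" unfolding bpt_scale[OF k] .
  qed
qed


text \<open>On a line \<open>m y + n z = 0\<close> through \<open>A\<close> every point other than \<open>A\<close> is \<open>(x : n : - m)\<close> for some \<open>x\<close>, and
  it lies on the circumcircle iff \<open>x (c\<^sup>2 n - b\<^sup>2 m) = a\<^sup>2 n m\<close>. So a second common point exists
  unless \<open>c\<^sup>2 n = b\<^sup>2 m\<close>, which is the tangent.\<close>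
lemma tangent_line_A:
  "tangent_line (circumcircle A B C) A = bln 0 ((dist A B)\<^sup>2) ((dist C A)\<^sup>2)"
proof -
  define a b c where "a = (dist B C)\<^sup>2" and "b = (dist C A)\<^sup>2" and "c = (dist A B)\<^sup>2"
  have abc: "a > 0" "b > 0" "c > 0" using vertices_distinct by (auto simp: a_def b_def c_def)
  define S where "S = ordinary ` circumcircle A B C"
  have S: "bpt x y z \<in> S \<longleftrightarrow> a * (y * z) + b * (z * x) + c * (x * y) = 0"
    if "(x, y, z) \<noteq> (0, 0, 0)" for x y z
    unfolding S_def bpt_in_circumcircle[OF that] a_def b_def c_def ..
  have A1: "ordinary A = bpt 1 0 0" by (rule ordinary_vertices)
  have A0: "(1, 0, 0) \<noteq> (0::real, 0::real, 0::real)" by simp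
  have "tangent_line (circumcircle A B C) A = bln 0 c b"
    unfolding tangent_line_def S_def[symmetric] A1
  proof (rule the_equality, rule conjI)
    have "join (bpt 1 0 0) (bpt 0 b (- c)) = bln 0 c b"
      using abc by (subst join_bpt) auto
    moreover have "bpt 1 0 0 \<noteq> bpt 0 b (- c)" using abc by (intro bpt_neqI) auto
    ultimately show "is_line (bln 0 c b)" unfolding is_line_def by metis
    show "bln 0 c b \<inter> S = {bpt 1 0 0}"
    proof (rule equalityI; rule subsetI)
      fix X assume X: "X \<in> bln 0 c b \<inter> S"
      obtain x y z where nz: "(x, y, z) \<noteq> (0, 0, 0)" and Xe: "X = bpt x y z" by (rule bpt_cases)
      from X have e: "c * y + b * z = 0" "a * (y * z) + b * (z * x) + c * (x * y) = 0"
        unfolding Xe Int_iff bpt_in_bln[OF nz] S[OF nz] by simp_all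
      then have "a * c * (y * y) = 0" "a * b * (z * z) = 0" by algebra+
      then have yz: "y = 0" "z = 0" using abc by auto
      have "X = bpt 1 0 0"
        unfolding Xe using yz by (intro bpt_eqI nz) auto
      then show "X \<in> {bpt 1 0 0}" by simp
    next
      fix X assume "X \<in> {bpt 1 0 0}"
      then show "X \<in> bln 0 c b \<inter> S" using bpt_in_bln[OF A0] S[OF A0] by simp
    qed
  next
    fix L assume L: "is_line L \<and> L \<inter> S = {bpt 1 0 0}"
    then obtain l m n where lmn: "(l, m, n) \<noteq> (0, 0, 0)" "L = bln l m n"
      using is_line_bln by metis
    from L have "bpt 1 0 0 \<in> bln l m n" unfolding lmn by blast
    then have l: "l = 0" unfolding bpt_in_bln[OF A0] by simp
    have cn: "c * n = b * m"
    proof (rule ccontr)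
      assume ne: "c * n \<noteq> b * m"
      \<comment> \<open>The first coordinate of the second intersection \<open>(x : n : - m)\<close> of \<open>L\<close> with the circle.\<close>
      define x where "x = a * (n * m) / (c * n - b * m)"
      have x: "x * (c * n - b * m) = a * (n * m)" using ne by (simp add: x_def)
      have nz: "(x, n, - m) \<noteq> (0, 0, 0)" using lmn(1) l by auto
      have "bpt x n (- m) \<in> L" unfolding lmn(2) bpt_in_bln[OF nz] using l by simp
      moreover have "bpt x n (- m) \<in> S"
        unfolding S[OF nz] using x by (simp add: algebra_simps)
      ultimately have "bpt x n (- m) \<in> L \<inter> S" by blast
      then have "bpt 1 0 0 = bpt x n (- m)" using L by simp
      then have "n = 0" "m = 0" unfolding bpt_eq_iff[OF A0 nz] by auto
      with ne show False by simp
    qed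
    define k where "k = m / c"
    have k: "m = k * c" "n = k * b" using abc cn by (simp_all add: k_def field_simps)
    then have "k \<noteq> 0" using lmn(1) l by auto
    then show "L = bln 0 c b" unfolding lmn(2) l k using bln_scale[of k 0 c b] by simp
  qed
  then show ?thesis by (simp only: b_def c_def)
qed

lemma tangential_vertex_A:
  "meet (tangent_line (circumcircle A B C) B) (tangent_line (circumcircle A B C) C) =
    bpt (- (dist B C)\<^sup>2) ((dist C A)\<^sup>2) ((dist A B)\<^sup>2)"
proof -
  interpret BCA: nondegenerate_triangle B C A by (rule cyclic)
  interpret CAB: nondegenerate_triangle C A B by (rule BCA.cyclic)
  define a b c where "a = (dist B C)\<^sup>2" and "b = (dist C A)\<^sup>2" and "c = (dist A B)\<^sup>2"
  have abc: "a \<noteq> 0" "b \<noteq> 0" "c \<noteq> 0" using vertices_distinct by (auto simp: a_def b_def c_def)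
  have 1: "tangent_line (circumcircle A B C) B = bln c 0 a"
    using BCA.tangent_line_A
    unfolding circumcircle_cyclic[of B C A] bary_line_cyclic[of B C A] a_def c_def .
  have 2: "tangent_line (circumcircle A B C) C = bln b a 0"
    using CAB.tangent_line_A
    unfolding circumcircle_cyclic[of A B C, symmetric] bary_line_cyclic[of A B C, symmetric]
      a_def b_def .
  have "meet (bln c 0 a) (bln b a 0) = bpt (a * - a) (a * b) (a * c)"
    using abc by (subst meet_bln) (auto simp: mult.commute)
  then show ?thesis
    unfolding 1 2 bpt_scale[OF abc(1)] by (simp only: a_def b_def c_def)
qed

text \<open>The formula includes the tangent case \<open>m = 0\<close>, in which it gives \<open>A\<close> itself.\<close>
lemma second_intersection_A:
  assumes vw: "(v, w) \<noteq> (0, 0)"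
  defines "m \<equiv> (dist C A)\<^sup>2 * w + (dist A B)\<^sup>2 * v"
  shows "second_intersection (circumcircle A B C) A (bpt u v w) =
    bpt (- ((dist B C)\<^sup>2 * (v * w))) (v * m) (w * m)"
proof -
  define a b c where "a = (dist B C)\<^sup>2" and "b = (dist C A)\<^sup>2" and "c = (dist A B)\<^sup>2"
  have abc: "a > 0" "b > 0" "c > 0" using vertices_distinct by (auto simp: a_def b_def c_def)
  have m: "m = b * w + c * v" by (simp add: m_def b_def c_def)
  define S where "S = ordinary ` circumcircle A B C"
  have S: "bpt x y z \<in> S \<longleftrightarrow> a * (y * z) + b * (z * x) + c * (x * y) = 0"
    if "(x, y, z) \<noteq> (0, 0, 0)" for x y z
    unfolding S_def bpt_in_circumcircle[OF that] a_def b_def c_def ..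
  have A1: "ordinary A = bpt 1 0 0" by (rule ordinary_vertices)
  have A0: "(1, 0, 0) \<noteq> (0::real, 0::real, 0::real)" by simp
  let ?Y = "bpt (- (a * (v * w))) (v * m) (w * m)"
  have Y0: "(- (a * (v * w)), v * m, w * m) \<noteq> (0, 0, 0)" using vw abc m by auto
  have "join (ordinary A) (bpt u v w) \<inter> S = {ordinary A, ?Y}"
    unfolding cevian_A[OF vw] unfolding A1
  proof (rule equalityI; rule subsetI)
    fix X assume X: "X \<in> bln 0 (- w) v \<inter> S"
    obtain x y z where nz: "(x, y, z) \<noteq> (0, 0, 0)" and Xe: "X = bpt x y z" by (rule bpt_cases)
    from X have e: "v * z = w * y" and f: "a * (y * z) + b * (z * x) + c * (x * y) = 0"
      unfolding Xe Int_iff bpt_in_bln[OF nz] S[OF nz] by simp_all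
    have "\<exists>k. y = k * v \<and> z = k * w"
    proof (cases "v = 0")
      case True
      with vw e show ?thesis by (intro exI[of _ "z / w"]) auto
    next
      case False
      with e show ?thesis by (intro exI[of _ "y / v"]) (auto simp: field_simps)
    qed
    then obtain k where k: "y = k * v" "z = k * w" by blast
    show "X \<in> {bpt 1 0 0, ?Y}"
    proof (cases "k = 0")
      case True
      then have "X = bpt 1 0 0" unfolding Xe using k by (intro bpt_eqI nz) auto
      then show ?thesis by simp
    next
      case False
      have "k * (x * m + k * (a * (v * w))) = 0"
        using f unfolding k m by (simp add: algebra_simps)
      with False have xm: "x * m = - (k * (a * (v * w)))" by simp
      have "X = ?Y" unfolding Xe
      proof (intro bpt_eqI nz Y0)
        have "x * (w * m) = w * (x * m)" "x * (v * m) = v * (x * m)" by simp_all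
        then show "z * - (a * (v * w)) = x * (w * m)" "x * (v * m) = y * - (a * (v * w))"
          unfolding xm k by simp_all
        show "y * (w * m) = z * (v * m)" unfolding k by simp
      qed
      then show ?thesis by simp
    qed
  next
    fix X assume "X \<in> {bpt 1 0 0, ?Y}"
    moreover have "bpt 1 0 0 \<in> bln 0 (- w) v \<inter> S" using bpt_in_bln[OF A0] S[OF A0] by simp
    moreover have "?Y \<in> bln 0 (- w) v \<inter> S"
      unfolding Int_iff bpt_in_bln[OF Y0] S[OF Y0] by (simp add: m algebra_simps)
    ultimately show "X \<in> bln 0 (- w) v \<inter> S" by blast
  qed
  then have "second_intersection (circumcircle A B C) A (bpt u v w) = ?Y"
    unfolding second_intersection_def S_def[symmetric]
    by (intro the_equality) (auto simp: doubleton_eq_iff)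
  then show ?thesis by (simp only: a_def)
qed

end

section \<open>The perspector\<close>

context nondegenerate_triangle
begin

lemma perspector_line_A:
  assumes q: "q1 * q2 * q3 \<noteq> 0"
  defines "a \<equiv> (dist B C)\<^sup>2" and "b \<equiv> (dist C A)\<^sup>2" and "c \<equiv> (dist A B)\<^sup>2"
  defines "R \<equiv> bpt (a * (q2 * q3)) (b * (q3 * q1)) (c * (q1 * q2))"
    and "T \<equiv> meet (tangent_line (circumcircle A B C) B) (tangent_line (circumcircle A B C) C)"
  shows "T \<noteq> second_intersection (circumcircle A B C) A R"
    and "join T (second_intersection (circumcircle A B C) A R) =
      bln (b * c * (q2\<^sup>2 - q3\<^sup>2)) (c * a * q2\<^sup>2) (- (a * b * q3\<^sup>2))"
proof -
  have abc: "a \<noteq> 0" "b \<noteq> 0" "c \<noteq> 0" using vertices_distinct by (auto simp: a_def b_def c_def)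
  have nz: "q1 \<noteq> 0" "q2 \<noteq> 0" "q3 \<noteq> 0" using q by auto
  have T: "T = bpt (- a) b c" unfolding T_def tangential_vertex_A a_def b_def c_def ..
  let ?v = "b * (q3 * q1)" and ?w = "c * (q1 * q2)"
  have "second_intersection (circumcircle A B C) A R =
      bpt (- (a * (?v * ?w))) (?v * (b * ?w + c * ?v)) (?w * (b * ?w + c * ?v))"
    unfolding R_def a_def b_def c_def
    by (rule second_intersection_A) (use nz abc in \<open>auto simp: b_def c_def\<close>)
  also have "\<dots> = bpt ((b * c * q1\<^sup>2) * - (a * (q2 * q3))) ((b * c * q1\<^sup>2) * (b * (q3 * (q2 + q3))))
      ((b * c * q1\<^sup>2) * (c * (q2 * (q2 + q3))))"
    by (simp add: power2_eq_square algebra_simps)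
  also have "\<dots> = bpt (- (a * (q2 * q3))) (b * (q3 * (q2 + q3))) (c * (q2 * (q2 + q3)))"
    using nz abc by (intro bpt_scale) simp
  finally have A': "second_intersection (circumcircle A B C) A R =
    bpt (- (a * (q2 * q3))) (b * (q3 * (q2 + q3))) (c * (q2 * (q2 + q3)))" (is "_ = bpt ?x ?y ?z") .
  have e: "b * ?z - c * ?y = b * c * (q2\<^sup>2 - q3\<^sup>2)" "c * ?x - - a * ?z = c * a * q2\<^sup>2"
    "- a * ?y - b * ?x = - (a * b * q3\<^sup>2)"
    by (simp_all add: power2_eq_square algebra_simps)
  have cross: "(b * ?z - c * ?y, c * ?x - - a * ?z, - a * ?y - b * ?x) \<noteq> (0, 0, 0)"
    unfolding e using abc nz by simp
  show "T \<noteq> second_intersection (circumcircle A B C) A R"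
    unfolding T A' using cross by (rule bpt_neqI)
  show "join T (second_intersection (circumcircle A B C) A R) =
      bln (b * c * (q2\<^sup>2 - q3\<^sup>2)) (c * a * q2\<^sup>2) (- (a * b * q3\<^sup>2))"
    unfolding T A' join_bpt[OF cross] e ..
qed

text \<open>The theorem for an arbitrary point \<open>Q\<close> off the side lines. Cross products of two of the three lines
  are multiples of the claimed point; the hypothesis on its first coordinate guarantees
  that it is a point.\<close>
lemma perspector_of_circumcevian:
  assumes q: "q1 * q2 * q3 \<noteq> 0" and ne: "q2\<^sup>2 + q3\<^sup>2 - q1\<^sup>2 \<noteq> 0"
  defines "a \<equiv> (dist B C)\<^sup>2" and "b \<equiv> (dist C A)\<^sup>2" and "c \<equiv> (dist A B)\<^sup>2"
  shows "is_perspector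
    (bpt (a * (q2\<^sup>2 + q3\<^sup>2 - q1\<^sup>2)) (b * (q3\<^sup>2 + q1\<^sup>2 - q2\<^sup>2)) (c * (q1\<^sup>2 + q2\<^sup>2 - q3\<^sup>2)))
    (tangential_triangle A B C)
    (circumcevian_triangle A B C (isogonal A B C (bpt q1 q2 q3)))"
proof -
  interpret BCA: nondegenerate_triangle B C A by (rule cyclic)
  interpret CAB: nondegenerate_triangle C A B by (rule BCA.cyclic)
  have abc: "a \<noteq> 0" "b \<noteq> 0" "c \<noteq> 0" using vertices_distinct by (auto simp: a_def b_def c_def)
  have nz: "q1 \<noteq> 0" "q2 \<noteq> 0" "q3 \<noteq> 0" using q by auto
  have q': "q2 * q3 * q1 \<noteq> 0" "q3 * q1 * q2 \<noteq> 0" using nz by simp_all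
  note cyc = bary_point_cyclic[of B C A] bary_point_cyclic[of A B C, symmetric]
    bary_line_cyclic[of B C A] bary_line_cyclic[of A B C, symmetric]
    circumcircle_cyclic[of B C A] circumcircle_cyclic[of A B C, symmetric]
  note folds = a_def[symmetric] b_def[symmetric] c_def[symmetric]
  note 1 = perspector_line_A[OF q, unfolded folds]
  note 2 = BCA.perspector_line_A[OF q'(1), unfolded cyc folds]
  note 3 = CAB.perspector_line_A[OF q'(2), unfolded cyc folds]
  let ?LA = "bln (b * c * (q2\<^sup>2 - q3\<^sup>2)) (c * a * q2\<^sup>2) (- (a * b * q3\<^sup>2))"
  let ?LB = "bln (- (b * c * q1\<^sup>2)) (c * a * (q3\<^sup>2 - q1\<^sup>2)) (a * b * q3\<^sup>2)"
  let ?LC = "bln (b * c * q1\<^sup>2) (- (c * a * q2\<^sup>2)) (a * b * (q1\<^sup>2 - q2\<^sup>2))"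
  let ?x = "a * (q2\<^sup>2 + q3\<^sup>2 - q1\<^sup>2)" and ?y = "b * (q3\<^sup>2 + q1\<^sup>2 - q2\<^sup>2)"
    and ?z = "c * (q1\<^sup>2 + q2\<^sup>2 - q3\<^sup>2)"
  have X0: "(?x, ?y, ?z) \<noteq> (0, 0, 0)" using abc ne by simp
  let ?k = "a * b * c * q3\<^sup>2"
  have k: "?k \<noteq> 0" using abc nz by simp
  have e: "c * a * q2\<^sup>2 * (a * b * q3\<^sup>2) - - (a * b * q3\<^sup>2) * (c * a * (q3\<^sup>2 - q1\<^sup>2)) = ?k * ?x"
    "- (a * b * q3\<^sup>2) * - (b * c * q1\<^sup>2) - b * c * (q2\<^sup>2 - q3\<^sup>2) * (a * b * q3\<^sup>2) = ?k * ?y"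
    "b * c * (q2\<^sup>2 - q3\<^sup>2) * (c * a * (q3\<^sup>2 - q1\<^sup>2)) - c * a * q2\<^sup>2 * - (b * c * q1\<^sup>2) = ?k * ?z"
    by (simp_all add: algebra_simps)
  have AB: "?LA \<inter> ?LB = {bpt ?x ?y ?z}"
    by (subst bln_Int_bln) (unfold e bpt_scale[OF k], use X0 k in auto)
  have "bpt ?x ?y ?z \<in> ?LC" unfolding bpt_in_bln[OF X0] by (simp add: algebra_simps)
  with AB have ABC: "?LA \<inter> ?LB \<inter> ?LC = {bpt ?x ?y ?z}" by blast
  have R: "isogonal A B C (bpt q1 q2 q3) = bpt (a * (q2 * q3)) (b * (q3 * q1)) (c * (q1 * q2))"
    unfolding a_def b_def c_def using q by (rule isogonal_bpt)
  show ?thesis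
    unfolding R is_perspector_def tangential_triangle_def circumcevian_triangle_def Let_def prod.case
    unfolding 1(2) 2(2) 3(2) using 1(1) 2(1) 3(1) ABC by blast
qed

end

theorem mainTheorem1:
  fixes A B C p :: "real^2" and P Q H :: ppoint
  assumes "\<not> collinear {A, B, C}"
    and "P = ordinary p"
    and "P \<notin> sides A B C"
    and "P \<notin> complement A B C -` sides A B C"
    and "P \<notin> isotomic A B C ` line_at_infinity"
    and "Q = isotomcomplement A B C P"
    and "H = generalized_orthocenter A B C P"
    and "H \<noteq> ordinary A" and "H \<noteq> ordinary B" and "H \<noteq> ordinary C"
  shows "is_perspector (isogonal A B C H)
           (tangential_triangle A B C)
           (circumcevian_triangle A B C (isogonal A B C Q))"
proof -
  interpret nondegenerate_triangle A B C using assms(1) by unfold_locales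
  obtain p1 p2 p3 where nz: "(p1, p2, p3) \<noteq> (0, 0, 0)" and P: "P = bpt p1 p2 p3"
    by (rule bpt_cases)
  have p: "p1 * p2 * p3 \<noteq> 0"
    using assms(3) unfolding sides_bln P Un_iff bpt_in_bln[OF nz] by simp
  have nz': "(p2 + p3, p3 + p1, p1 + p2) \<noteq> (0, 0, 0)" using nz by auto
  have p': "p2 + p3 \<noteq> 0" "p3 + p1 \<noteq> 0" "p1 + p2 \<noteq> 0"
    using assms(4) unfolding sides_bln P vimage_eq complement_bpt[OF nz] Un_iff bpt_in_bln[OF nz']
    by simp_all
  define s where "s = p2 * p3 + p3 * p1 + p1 * p2"
  define q1 q2 q3 where "q1 = p1 * (p2 + p3)" and "q2 = p2 * (p3 + p1)" and "q3 = p3 * (p1 + p2)"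
  have Q: "Q = bpt q1 q2 q3"
    unfolding assms(6) P isotomcomplement_bpt[OF p] q1_def q2_def q3_def ..
  have H: "s \<noteq> p1\<^sup>2" "isogonal A B C H = bpt ((dist B C)\<^sup>2 * (p2 * p3 * (s - p1\<^sup>2)))
    ((dist C A)\<^sup>2 * (p3 * p1 * (s - p2\<^sup>2))) ((dist A B)\<^sup>2 * (p1 * p2 * (s - p3\<^sup>2)))"
    using isogonal_generalized_orthocenter[OF p p' s_def] assms(8-10) unfolding assms(7) P by simp_all
  \<comment> \<open>The identity linking \<open>Q\<close> with \<open>H\<close>: the perspector determined by \<open>Q\<close> is \<open>\<gamma>(H)\<close>.\<close>
  have q: "q2\<^sup>2 + q3\<^sup>2 - q1\<^sup>2 = 2 * (p2 * p3 * (s - p1\<^sup>2))"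
    "q3\<^sup>2 + q1\<^sup>2 - q2\<^sup>2 = 2 * (p3 * p1 * (s - p2\<^sup>2))"
    "q1\<^sup>2 + q2\<^sup>2 - q3\<^sup>2 = 2 * (p1 * p2 * (s - p3\<^sup>2))"
    unfolding q1_def q2_def q3_def s_def by (simp_all add: power2_eq_square algebra_simps)
  have "q1 * q2 * q3 \<noteq> 0" using p p' by (simp add: q1_def q2_def q3_def)
  moreover have "q2\<^sup>2 + q3\<^sup>2 - q1\<^sup>2 \<noteq> 0" unfolding q using p H(1) by simp
  ultimately have "is_perspector (bpt ((dist B C)\<^sup>2 * (q2\<^sup>2 + q3\<^sup>2 - q1\<^sup>2))
      ((dist C A)\<^sup>2 * (q3\<^sup>2 + q1\<^sup>2 - q2\<^sup>2)) ((dist A B)\<^sup>2 * (q1\<^sup>2 + q2\<^sup>2 - q3\<^sup>2)))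
    (tangential_triangle A B C) (circumcevian_triangle A B C (isogonal A B C (bpt q1 q2 q3)))"
    by (rule perspector_of_circumcevian)
  then show ?thesis
    unfolding Q H(2) q mult.left_commute[of _ 2] by (simp only: bpt_scale)
qed

end
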